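(* Let $A \in \mathbb{C}^{N \times M}$ with $A = Z + F$, where $\mathrm{rank}\, Z = r \ge 1$ and $\Vert F \Vert_2 \le \varepsilon$. Let $n, m$ be integers with $m \ge n \ge r$, $n < N$, $m < M$. Let $\widetilde{A}$ be a rectangular pseudo-skeleton approximant of $A$ built from $Z$ with $n$ rows and $m$ columns, the basis rows and basis columns being selected spectrally optimally (see context; the matrix $R$ of selected rows is assumed to have full row rank $n$). Then $$\Vert A - \widetilde{A} \Vert_2 \le \varepsilon \, t(n, M, m)\, t(r, N, n).$$
   Context: $\Vert\cdot\Vert_2$ is the spectral norm, $X^\dagger$ is the Moore–Penrose pseudo-inverse, and $\sigma_{\min}$ is the smallest singular value. Definition of $t(r,n,k)$ for integers $n \ge k \ge r \ge 1$: let $\mathcal{P}(n,r)$ be the set of all $n \times r$ complex matrices with orthonormal columns, and for $U \in \mathcal{P}(n,r)$ let $\mathcal{M}_k(U)$ be the set of all $k \times r$ submatrices of $U$ (formed by $k$ distinct rows). Then $$t(r,n,k) = \Big[ \min_{U \in \mathcal{P}(n,r)} \max_{\widehat{U} \in \mathcal{M}_k(U)} \sigma_{\min}(\widehat{U}) \Big]^{-1}.$$ Basis rows: for a $p \times q$ matrix $B$ of full column rank $q$, a choice of $k \ge q$ rows is called a set of basis rows if every other row of $B$ is a linear combination of them (equivalently, the submatrix $\widehat{B} \in \mathbb{C}^{k \times q}$ on these rows has rank $q$). The selection is spectrally optimal if the spectral norm of $B\widehat{B}^\dagger$ (the minimum norm solution $C$ of $C\widehat{B} = B$) is the smallest possible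 among all sets of $k$ basis rows. Basis columns of a matrix of full row rank, and their spectrally optimal selection, are defined analogously by transposition. Rectangular pseudo-skeleton approximant of $A$ built from $Z$ with $n$ rows and $m \ge n$ columns: write $Z = Z_U Z_V$ with $Z_U \in \mathbb{C}^{N \times r}$, $Z_V \in \mathbb{C}^{r \times M}$; select $n$ basis rows of $Z_U$; let $R \in \mathbb{C}^{n \times M}$ be the submatrix of $A$ on the corresponding rows; select $m$ basis columns of $R$; let $C \in \mathbb{C}^{N \times m}$ be the submatrix of $A$ on the corresponding columns; let $\widehat{A} \in \mathbb{C}^{n \times m}$ be the submatrix of $A$ on the intersection of the selected rows and columns. The approximant is $\widetilde{A} = C\widehat{A}^\dagger R$. *)

theory Defs
  imports
    "HOL-Analysis.L2_Norm"
    "Jordan_Normal_Form.Matrix"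
    "Jordan_Normal_Form.Char_Poly"
    "Jordan_Normal_Form.Schur_Decomposition"
    "Jordan_Normal_Form.DL_Rank"
    "Jordan_Normal_Form.DL_Submatrix"
begin

definition vec_norm2 :: "complex vec \<Rightarrow> real" where
  "vec_norm2 x = L2_set (\<lambda>i. cmod (x $ i)) {..<dim_vec x}"

definition spectral_norm :: "complex mat \<Rightarrow> real" where
  "spectral_norm A =
     (SUP x \<in> {x \<in> carrier_vec (dim_col A). vec_norm2 x \<le> 1}. vec_norm2 (A *\<^sub>v x))"

text \<open>A \<open>p \<times> q\<close> matrix has \<open>min p q\<close> singular values (with multiplicity), the square roots of the
  eigenvalues of the smaller of its two Gram matrices. As only the smallest one is needed,
  multiplicities are dropped.\<close>

definition singular_values :: "complex mat \<Rightarrow> real set" where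
  "singular_values A =
     {s. s \<ge> 0 \<and>
         eigenvalue (if dim_col A \<le> dim_row A then mat_adjoint A * A else A * mat_adjoint A)
           (complex_of_real (s\<^sup>2))}"

definition sigma_min :: "complex mat \<Rightarrow> real" where
  "sigma_min A = Min (singular_values A)"

text \<open>The Moore--Penrose pseudo-inverse is the unique solution of the four Penrose equations.\<close>

definition is_pseudo_inverse :: "complex mat \<Rightarrow> complex mat \<Rightarrow> bool" where
  "is_pseudo_inverse A X \<longleftrightarrow>
     X \<in> carrier_mat (dim_col A) (dim_row A) \<and>
     A * X * A = A \<and>
     X * A * X = X \<and>
     mat_adjoint (A * X) = A * X \<and>
     mat_adjoint (X * A) = X * A"

definition pseudo_inverse :: "complex mat \<Rightarrow> complex mat" where
  "pseudo_inverse A = (THE X. is_pseudo_inverse A X)"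

definition select_rows :: "'a mat \<Rightarrow> nat set \<Rightarrow> 'a mat" where
  "select_rows A I = submatrix A I UNIV"

definition select_cols :: "'a mat \<Rightarrow> nat set \<Rightarrow> 'a mat" where
  "select_cols A J = submatrix A UNIV J"

definition orthonormal_column_mats :: "nat \<Rightarrow> nat \<Rightarrow> complex mat set" where
  "orthonormal_column_mats n r = {U \<in> carrier_mat n r. mat_adjoint U * U = 1\<^sub>m r}"

text \<open>Meant for \<open>n \<ge> k \<ge> r \<ge> 1\<close>. The infimum is a minimum: the inner maximum is
  continuous in \<open>U\<close>, which ranges over a compact nonempty set.\<close>

definition t_bound :: "nat \<Rightarrow> nat \<Rightarrow> nat \<Rightarrow> real" where
  "t_bound r n k =
     inverse (INF U \<in> orthonormal_column_mats n r.
       Max {sigma_min (select_rows U I) | I. I \<subseteq> {..<n} \<and> card I = k})"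

text \<open>For \<open>B\<close> of full column rank. A choice of rows is given by the set \<open>I\<close> of their (0-based)
  indices. Rows inside \<open>I\<close> are trivially in the span.\<close>

definition basis_rows :: "complex mat \<Rightarrow> nat \<Rightarrow> nat set \<Rightarrow> bool" where
  "basis_rows B k I \<longleftrightarrow>
     I \<subseteq> {..<dim_row B} \<and> card I = k \<and>
     (\<forall>i \<in> {..<dim_row B} - I.
        row B i \<in> vec_space.row_space (dim_col B) (select_rows B I))"

definition optimal_basis_rows :: "complex mat \<Rightarrow> nat \<Rightarrow> nat set \<Rightarrow> bool" where
  "optimal_basis_rows B k I \<longleftrightarrow>
     is_arg_min (\<lambda>I. spectral_norm (B * pseudo_inverse (select_rows B I))) (basis_rows B k) I"

definition optimal_basis_columns :: "complex mat \<Rightarrow> nat \<Rightarrow> nat set \<Rightarrow> bool" where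
  "optimal_basis_columns B k J \<longleftrightarrow> optimal_basis_rows (transpose_mat B) k J"

definition pseudo_skeleton :: "complex mat \<Rightarrow> nat set \<Rightarrow> nat set \<Rightarrow> complex mat" where
  "pseudo_skeleton A I J =
     select_cols A J * pseudo_inverse (submatrix A I J) * select_rows A I"

text \<open>\<open>A\<^sub>t\<close> is a pseudo-skeleton approximant of \<open>A\<close> built from \<open>Z\<close>, a matrix of rank \<open>r\<close>, with \<open>n\<close> rows
  and \<open>m\<close> columns, both selected spectrally optimally. Basis columns of the selected rows of \<open>A\<close>
  make sense only if these are linearly independent, hence the rank condition.\<close>

definition optimal_pseudo_skeleton_approximant ::
  "complex mat \<Rightarrow> complex mat \<Rightarrow> nat \<Rightarrow> nat \<Rightarrow> nat \<Rightarrow> complex mat \<Rightarrow> bool" where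
  "optimal_pseudo_skeleton_approximant A Z r n m A\<^sub>t \<longleftrightarrow>
     (\<exists>Z\<^sub>U Z\<^sub>V I J.
        Z\<^sub>U \<in> carrier_mat (dim_row Z) r \<and> Z\<^sub>V \<in> carrier_mat r (dim_col Z) \<and> Z = Z\<^sub>U * Z\<^sub>V \<and>
        optimal_basis_rows Z\<^sub>U n I \<and>
        vec_space.rank n (select_rows A I) = n \<and>
        optimal_basis_columns (select_rows A I) m J \<and>
        A\<^sub>t = pseudo_skeleton A I J)"

end

(* Let I and J be the selected rows and columns, R the selected rows of A, and put
   P = Z_U (Z_U[I])^+ S_I, where S_I picks the coordinates in I, and Q likewise for the columns,
   built from R. Both are oblique projections with P Z = Z and R Q = R, and the approximant
   is A Q. Since P A depends on A only through R, P A (1 - Q) = 0 and hence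
   A - A Q = (1 - P) A (1 - Q) = (1 - P) F (1 - Q).
   It remains to bound 1 - P and 1 - Q. The norm of the complement of an oblique projection is at
   most max 1 ||P||. Writing Z_U = U T with orthonormal columns of U, a row set for which
   sigma_min of U[I] is largest gives a competitor of norm at most 1 / sigma_min(U[I]), which is at
   most t(r, N, n). The reciprocal is meaningful only because the infimum defining t is positive:
   Gaussian elimination with complete pivoting selects rows with a lower bound on sigma_min that
   does not depend on U. *)

theory Submission
  imports Defs
begin

section \<open>Norms and adjoints\<close>

text \<open>With S the selection of J, the chosen columns are \<open>A S^T\<close> and the core is
  \<open>R S^T\<close>, so the approximant is A Q for \<open>Q = S^T (R S^T)^+ R\<close>.
  Pseudo-inverses commute with transposition, hence columns are treated as rows of
  \<open>R\<^sup>T\<close>; that matrix has rank n rather than r, which is where t(n, M, m) comes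
  from. The competitor bound rests on |B x| = |T x| <= |U[I] T x| / sigma_min(U[I]) for B = U T.
  Since U[I] T = B[I], the factor T cancels, and B[I] B[I]^+ is an orthogonal projection, of norm at
  most 1. The maximum with 1 is absorbed because sigma_min(U[I]) <= 1, so that t >= 1. A positive
  value for each single U does not keep the infimum away from 0, and \<open>inverse 0 = 0\<close>
  would then turn the bound into a false one. A constant uniform in U takes the place of a
  continuity and compactness argument.\<close>

lemma vec_norm2_nonneg [simp]: "vec_norm2 x \<ge> 0"
  by (simp add: vec_norm2_def L2_set_nonneg)

lemma vec_norm2_power2: "(vec_norm2 x)\<^sup>2 = (\<Sum>i<dim_vec x. (cmod (x $ i))\<^sup>2)"
  by (simp add: vec_norm2_def L2_set_def sum_nonneg)

lemma vec_norm2_eq_0_iff: "x \<in> carrier_vec n \<Longrightarrow> vec_norm2 x = 0 \<longleftrightarrow> x = 0\<^sub>v n"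
  by (auto simp: vec_norm2_def L2_set_eq_0_iff)

lemma vec_norm2_pos_iff: "x \<in> carrier_vec n \<Longrightarrow> vec_norm2 x > 0 \<longleftrightarrow> x \<noteq> 0\<^sub>v n"
  using vec_norm2_eq_0_iff[of x n] vec_norm2_nonneg[of x] by linarith

lemma vec_norm2_zero [simp]: "vec_norm2 (0\<^sub>v n) = 0"
  by (simp add: vec_norm2_eq_0_iff[of _ n])

lemma vec_norm2_smult: "vec_norm2 (c \<cdot>\<^sub>v x) = cmod c * vec_norm2 x"
  unfolding vec_norm2_def by (subst L2_set_right_distrib) (auto simp: norm_mult intro!: L2_set_cong)

lemma vec_norm2_conjugate [simp]: "vec_norm2 (conjugate x) = vec_norm2 x"
  unfolding vec_norm2_def by (auto intro!: L2_set_cong)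

lemma cmod_index_le_vec_norm2: "i < dim_vec x \<Longrightarrow> cmod (x $ i) \<le> vec_norm2 x"
  unfolding vec_norm2_def using member_le_L2_set[of "{..<dim_vec x}" i "\<lambda>i. cmod (x $ i)"] by simp

lemma vec_norm2_le_sum: "vec_norm2 x \<le> (\<Sum>i<dim_vec x. cmod (x $ i))"
  unfolding vec_norm2_def by (rule L2_set_le_sum) simp

lemma cscalar_prod_self: "x \<bullet>c x = complex_of_real ((vec_norm2 x)\<^sup>2)"
  unfolding vec_norm2_power2 scalar_prod_def
  by (simp add: complex_norm_square lessThan_atLeast0 del: of_real_power)

lemma cscalar_prod_cauchy_schwarz:
  assumes "dim_vec x = dim_vec y"
  shows "cmod (x \<bullet>c y) \<le> vec_norm2 x * vec_norm2 y"
proof -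
  have "cmod (x \<bullet>c y) \<le> (\<Sum>i<dim_vec y. \<bar>cmod (x $ i)\<bar> * \<bar>cmod (y $ i)\<bar>)"
    unfolding scalar_prod_def dim_vec_conjugate lessThan_atLeast0
    by (rule sum_norm_le) (simp add: norm_mult)
  also have "\<dots> \<le> vec_norm2 x * vec_norm2 y"
    unfolding vec_norm2_def assms by (rule L2_set_mult_ineq)
  finally show ?thesis .
qed

text \<open>Real coefficients merge the two cross terms into the real part of one inner product. The
  identity serves both the exchange of lengths in an oblique projection and the expansion of a
  quadratic form along a descent step.\<close>

lemma vec_norm2_power2_comb:
  assumes "u \<in> carrier_vec n" "v \<in> carrier_vec n"
  shows "(vec_norm2 (complex_of_real a \<cdot>\<^sub>v u + complex_of_real b \<cdot>\<^sub>v v))\<^sup>2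
    = a\<^sup>2 * (vec_norm2 u)\<^sup>2 + b\<^sup>2 * (vec_norm2 v)\<^sup>2 + 2 * a * b * Re (u \<bullet>c v)"
proof -
  have "(cmod (complex_of_real a * z + complex_of_real b * w))\<^sup>2
     = a\<^sup>2 * (cmod z)\<^sup>2 + b\<^sup>2 * (cmod w)\<^sup>2 + 2 * a * b * Re (z * cnj w)" for z w
    unfolding cmod_power2 by (simp add: power2_eq_square algebra_simps)
  then show ?thesis
    using assms unfolding vec_norm2_power2 scalar_prod_def
    by (simp add: sum.distrib sum_distrib_left distrib_left lessThan_atLeast0)
qed

section \<open>Adjoints and the inner product\<close>

lemma mat_adjoint_carrier [simp]: "A \<in> carrier_mat nr nc \<Longrightarrow> mat_adjoint A \<in> carrier_mat nc nr"
  by (auto simp: mat_adjoint_def)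

lemma dim_mat_adjoint [simp]:
  "dim_row (mat_adjoint A) = dim_col A" "dim_col (mat_adjoint A) = dim_row A"
  by (auto simp: mat_adjoint_def)

lemma mat_adjoint_index [simp]:
  "i < dim_col A \<Longrightarrow> j < dim_row A \<Longrightarrow> mat_adjoint A $$ (i, j) = conjugate (A $$ (j, i))"
  by (auto simp: mat_adjoint_def mat_of_rows_index)

lemma mat_adjoint_adjoint [simp]: "mat_adjoint (mat_adjoint A) = A"
  by (rule eq_matI) auto

lemma mat_adjoint_transpose: "mat_adjoint A\<^sup>T = (mat_adjoint A)\<^sup>T"
  by (rule eq_matI) auto

lemma mat_adjoint_mult:
  assumes "A \<in> carrier_mat nr k" "B \<in> carrier_mat k nc"
  shows "mat_adjoint (A * B :: complex mat) = mat_adjoint B * mat_adjoint A"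
  by (rule eq_matI) (use assms in \<open>auto simp: scalar_prod_def mult.commute intro!: sum.cong\<close>)

lemma cscalar_prod_adjoint:
  fixes A :: "complex mat"
  assumes "A \<in> carrier_mat nr nc" "x \<in> carrier_vec nc" "y \<in> carrier_vec nr"
  shows "(A *\<^sub>v x) \<bullet>c y = x \<bullet>c (mat_adjoint A *\<^sub>v y)"
proof -
  have "(A *\<^sub>v x) \<bullet>c y = (\<Sum>i<nr. \<Sum>j<nc. A $$ (i, j) * x $ j * cnj (y $ i))"
    using assms by (auto simp: scalar_prod_def sum_distrib_right lessThan_atLeast0 intro!: sum.cong)
  also have "\<dots> = (\<Sum>j<nc. \<Sum>i<nr. A $$ (i, j) * x $ j * cnj (y $ i))"
    by (rule sum.swap)
  also have "\<dots> = x \<bullet>c (mat_adjoint A *\<^sub>v y)"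
    using assms by (auto simp: scalar_prod_def sum_distrib_left lessThan_atLeast0 mult_ac intro!: sum.cong)
  finally show ?thesis .
qed

section \<open>Operator bounds and the spectral norm\<close>

lemma mult_mat_vec_bounded:
  "\<exists>K>0. \<forall>x \<in> carrier_vec (dim_col A). vec_norm2 (A *\<^sub>v x) \<le> K * vec_norm2 x"
proof (intro exI conjI ballI)
  \<comment> \<open>The summand 1 keeps the constant positive even for a zero or empty matrix,
    because such bounds later stand in denominators.\<close>
  let ?K = "(\<Sum>i<dim_row A. \<Sum>j<dim_col A. cmod (A $$ (i, j))) + 1"
  show "?K > 0" by (simp add: sum_nonneg add_nonneg_pos)
  fix x :: "complex vec" assume x: "x \<in> carrier_vec (dim_col A)"
  have "vec_norm2 (A *\<^sub>v x) \<le> (\<Sum>i<dim_row A. cmod ((A *\<^sub>v x) $ i))"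
    using vec_norm2_le_sum[of "A *\<^sub>v x"] by simp
  also have "\<dots> \<le> (\<Sum>i<dim_row A. \<Sum>j<dim_col A. cmod (A $$ (i, j)) * vec_norm2 x)"
  proof (rule sum_mono)
    fix i assume i: "i \<in> {..<dim_row A}"
    show "cmod ((A *\<^sub>v x) $ i) \<le> (\<Sum>j<dim_col A. cmod (A $$ (i, j)) * vec_norm2 x)"
      using x i
      by (auto simp: scalar_prod_def lessThan_atLeast0 norm_mult
        intro!: sum_norm_le mult_left_mono cmod_index_le_vec_norm2)
  qed
  also have "\<dots> = (\<Sum>i<dim_row A. \<Sum>j<dim_col A. cmod (A $$ (i, j))) * vec_norm2 x"
    by (simp add: sum_distrib_right)
  also have "\<dots> \<le> ?K * vec_norm2 x"
    by (simp add: algebra_simps)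
  finally show "vec_norm2 (A *\<^sub>v x) \<le> ?K * vec_norm2 x" .
qed

lemma bdd_above_spectral_norm:
  "bdd_above ((\<lambda>x. vec_norm2 (A *\<^sub>v x)) ` {x \<in> carrier_vec (dim_col A). vec_norm2 x \<le> 1})"
proof -
  obtain K where K: "K > 0" "\<And>x. x \<in> carrier_vec (dim_col A) \<Longrightarrow> vec_norm2 (A *\<^sub>v x) \<le> K * vec_norm2 x"
    using mult_mat_vec_bounded[of A] by auto
  show ?thesis
  proof (rule bdd_aboveI2)
    fix z assume z: "z \<in> {x \<in> carrier_vec (dim_col A). vec_norm2 x \<le> 1}"
    then have "vec_norm2 (A *\<^sub>v z) \<le> K * vec_norm2 z" by (intro K) simp
    also have "\<dots> \<le> K" using z K(1) by simp
    finally show "vec_norm2 (A *\<^sub>v z) \<le> K" .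
  qed
qed

lemma mult_mat_vec_le_spectral_norm:
  assumes "A \<in> carrier_mat nr nc" "x \<in> carrier_vec nc"
  shows "vec_norm2 (A *\<^sub>v x) \<le> spectral_norm A * vec_norm2 x"
proof (cases "x = 0\<^sub>v nc")
  case True
  then have "A *\<^sub>v x = 0\<^sub>v nr" using assms by auto
  then show ?thesis using True by simp
next
  case False
  have pos: "vec_norm2 x > 0" using False assms vec_norm2_pos_iff by blast
  define y where "y = complex_of_real (inverse (vec_norm2 x)) \<cdot>\<^sub>v x"
  have y: "y \<in> carrier_vec nc" "vec_norm2 y = 1"
    using assms pos by (auto simp: y_def vec_norm2_smult norm_inverse)
  have "vec_norm2 (A *\<^sub>v y) \<le> spectral_norm A"
    unfolding spectral_norm_def
  by (rule cSUP_upper[OF _ bdd_above_spectral_norm]) (use assms y in auto)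
  moreover have "A *\<^sub>v y = complex_of_real (inverse (vec_norm2 x)) \<cdot>\<^sub>v (A *\<^sub>v x)"
    unfolding y_def using assms by auto
  ultimately show ?thesis
    using pos by (simp add: vec_norm2_smult norm_inverse norm_divide field_simps)
qed

lemma spectral_norm_nonneg: "spectral_norm A \<ge> 0"
  using cSUP_upper[OF _ bdd_above_spectral_norm[of A], of "0\<^sub>v (dim_col A)"]
  unfolding spectral_norm_def by (auto intro: order_trans[OF vec_norm2_nonneg])

lemma spectral_norm_le:
  assumes "A \<in> carrier_mat nr nc" "c \<ge> 0"
    and "\<And>x. x \<in> carrier_vec nc \<Longrightarrow> vec_norm2 (A *\<^sub>v x) \<le> c * vec_norm2 x"
  shows "spectral_norm A \<le> c"
  unfolding spectral_norm_def
proof (rule cSUP_least)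
  show "{x \<in> carrier_vec (dim_col A). vec_norm2 x \<le> 1} \<noteq> {}"
    using vec_norm2_zero[of "dim_col A"] by (metis (mono_tags, lifting) empty_iff mem_Collect_eq zero_carrier_vec zero_le_one)
  fix x assume "x \<in> {x \<in> carrier_vec (dim_col A). vec_norm2 x \<le> 1}"
  then show "vec_norm2 (A *\<^sub>v x) \<le> c"
    using assms(3)[of x] assms(1,2) mult_left_mono[of "vec_norm2 x" 1 c] by auto
qed

lemma transpose_mult_vec_conjugate:
  fixes A :: "complex mat"
  assumes "A \<in> carrier_mat nr nc" "x \<in> carrier_vec nr"
  shows "A\<^sup>T *\<^sub>v x = conjugate (mat_adjoint A *\<^sub>v conjugate x)"
  by (rule eq_vecI) (use assms in \<open>auto simp: scalar_prod_def\<close>)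

text \<open>Since |A* x|^2 = <A A* x, x> <= c |A* x| |x|, one factor |A* x| can be cancelled unless
  it is zero. Through the transpose this carries the estimate for a complementary projection from
  rows over to columns.\<close>

lemma adjoint_mult_vec_bound:
  fixes A :: "complex mat"
  assumes A: "A \<in> carrier_mat nr nc" and c: "c \<ge> 0"
    and bound: "\<And>x. x \<in> carrier_vec nc \<Longrightarrow> vec_norm2 (A *\<^sub>v x) \<le> c * vec_norm2 x"
    and x: "x \<in> carrier_vec nr"
  shows "vec_norm2 (mat_adjoint A *\<^sub>v x) \<le> c * vec_norm2 x"
proof -
  let ?y = "mat_adjoint A *\<^sub>v x"
  have y: "?y \<in> carrier_vec nc"
    using mat_adjoint_carrier[OF A] x by (rule mult_mat_vec_carrier)
  have Ay: "A *\<^sub>v ?y \<in> carrier_vec nr" using A y by (rule mult_mat_vec_carrier)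
  have "complex_of_real ((vec_norm2 ?y)\<^sup>2) = (A *\<^sub>v ?y) \<bullet>c x"
    using cscalar_prod_adjoint[OF A y x] by (simp add: cscalar_prod_self)
  then have "(vec_norm2 ?y)\<^sup>2 = cmod ((A *\<^sub>v ?y) \<bullet>c x)"
    by (metis norm_of_real abs_of_nonneg zero_le_power2)
  also have "\<dots> \<le> vec_norm2 (A *\<^sub>v ?y) * vec_norm2 x"
    using Ay x by (intro cscalar_prod_cauchy_schwarz) (simp only: carrier_vecD)
  also have "\<dots> \<le> (c * vec_norm2 ?y) * vec_norm2 x"
    by (intro mult_right_mono bound y) auto
  finally have *: "vec_norm2 ?y * vec_norm2 ?y \<le> vec_norm2 ?y * (c * vec_norm2 x)"
    by (simp add: power2_eq_square mult_ac)
  show ?thesis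
  proof (cases "vec_norm2 ?y = 0")
    case False
    then have "vec_norm2 ?y > 0" using vec_norm2_nonneg[of ?y] by linarith
    with * show ?thesis by simp
  next
    case True
    then show ?thesis using c by simp
  qed
qed

lemma transpose_mult_vec_bound:
  fixes A :: "complex mat"
  assumes "A \<in> carrier_mat nr nc" "c \<ge> 0"
    and "\<And>x. x \<in> carrier_vec nc \<Longrightarrow> vec_norm2 (A *\<^sub>v x) \<le> c * vec_norm2 x"
    and "x \<in> carrier_vec nr"
  shows "vec_norm2 (A\<^sup>T *\<^sub>v x) \<le> c * vec_norm2 x"
  using adjoint_mult_vec_bound[OF assms(1-3), of "conjugate x"] assms(4)
  by (simp add: transpose_mult_vec_conjugate[OF assms(1)])

section \<open>Injective matrices and pseudo-inverses\<close>

text \<open>Full column rank in the form of a trivial kernel, which passes directly to right factors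
  and Gram matrices.\<close>

definition inj_mat :: "complex mat \<Rightarrow> bool" where
  "inj_mat A \<longleftrightarrow> (\<forall>x \<in> carrier_vec (dim_col A). A *\<^sub>v x = 0\<^sub>v (dim_row A) \<longrightarrow> x = 0\<^sub>v (dim_col A))"

lemma inj_matI:
  assumes "A \<in> carrier_mat nr nc"
    and "\<And>x. x \<in> carrier_vec nc \<Longrightarrow> A *\<^sub>v x = 0\<^sub>v nr \<Longrightarrow> x = 0\<^sub>v nc"
  shows "inj_mat A"
  using assms by (auto simp: inj_mat_def)

lemma inj_matD:
  assumes "inj_mat A" "A \<in> carrier_mat nr nc" "x \<in> carrier_vec nc" "A *\<^sub>v x = 0\<^sub>v nr"
  shows "x = 0\<^sub>v nc"
  using assms by (auto simp: inj_mat_def)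

lemma mult_zero_vec [simp]: "A \<in> carrier_mat nr nc \<Longrightarrow> A *\<^sub>v 0\<^sub>v nc = 0\<^sub>v nr"
  by auto

lemma inj_mat_mult_leftD:
  assumes AB: "inj_mat (A * B)" and A: "A \<in> carrier_mat nr k" and B: "B \<in> carrier_mat k nc"
  shows "inj_mat B"
proof (rule inj_matI[OF B])
  fix x assume x: "x \<in> carrier_vec nc" "B *\<^sub>v x = 0\<^sub>v k"
  then have "(A * B) *\<^sub>v x = 0\<^sub>v nr" using A B by simp
  then show "x = 0\<^sub>v nc" using inj_matD[OF AB mult_carrier_mat[OF A B] x(1)] by simp
qed

lemma inj_mat_square_inverse:
  assumes A: "A \<in> carrier_mat n n" and inj: "inj_mat A"
  obtains K where "K \<in> carrier_mat n n" "K * A = 1\<^sub>m n" "A * K = 1\<^sub>m n"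
proof -
  have "det A \<noteq> 0"
    using det_0_iff_vec_prod_zero_field[OF A] inj_matD[OF inj A] by blast
  from det_non_zero_imp_unit[OF A this, of "()"] show ?thesis
    by (auto simp: Units_def ring_mat_def intro: that)
qed

lemma inj_mat_left_inverse:
  assumes "K \<in> carrier_mat nc nr" "A \<in> carrier_mat nr nc" "K * A = 1\<^sub>m nc"
  shows "inj_mat A"
proof (rule inj_matI[OF assms(2)])
  fix x assume x: "x \<in> carrier_vec nc" "A *\<^sub>v x = 0\<^sub>v nr"
  have "x = (K * A) *\<^sub>v x" using x assms by simp
  also have "\<dots> = K *\<^sub>v (A *\<^sub>v x)" using assms x by (intro assoc_mult_mat_vec) auto
  also have "\<dots> = 0\<^sub>v nc" using x assms by simp
  finally show "x = 0\<^sub>v nc" .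
qed

lemma gram_cscalar_prod:
  fixes B :: "complex mat"
  assumes B: "B \<in> carrier_mat nr nc" and x: "x \<in> carrier_vec nc" and y: "y \<in> carrier_vec nc"
  shows "x \<bullet>c ((mat_adjoint B * B) *\<^sub>v y) = (B *\<^sub>v x) \<bullet>c (B *\<^sub>v y)"
  using cscalar_prod_adjoint[OF B x, of "B *\<^sub>v y"] assoc_mult_mat_vec[OF mat_adjoint_carrier[OF B] B y] B y
  by simp

lemma inj_mat_gram:
  assumes B: "B \<in> carrier_mat nr nc" and inj: "inj_mat B"
  shows "inj_mat (mat_adjoint B * B)"
proof (rule inj_matI)
  show "mat_adjoint B * B \<in> carrier_mat nc nc" using mult_carrier_mat[OF mat_adjoint_carrier[OF B] B] .
  fix x assume x: "x \<in> carrier_vec nc" "(mat_adjoint B * B) *\<^sub>v x = 0\<^sub>v nc"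
  then have "(B *\<^sub>v x) \<bullet>c (B *\<^sub>v x) = 0"
    using gram_cscalar_prod[OF B x(1) x(1)] x by simp
  then have "B *\<^sub>v x = 0\<^sub>v nr"
    using B x by (simp add: cscalar_prod_self vec_norm2_eq_0_iff[of _ nr])
  then show "x = 0\<^sub>v nc" using inj_matD[OF inj B x(1)] by simp
qed

text \<open>Taking adjoints of \<open>A * X = (A * Y) * (A * X)\<close> reverses the factors and
  yields \<open>A * X = A * Y\<close>; symmetrically \<open>X * A = Y * A\<close>. Then X = X A X =
  Y A X = Y A Y = Y. Uniqueness is what lets the definite description in
  \<open>pseudo_inverse\<close> be evaluated.\<close>

lemma is_pseudo_inverse_unique:
  assumes "is_pseudo_inverse A X" "is_pseudo_inverse A Y"
  shows "X = Y"
proof -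
  define nr nc where "nr = dim_row A" and "nc = dim_col A"
  have A: "A \<in> carrier_mat nr nc" by (auto simp: nr_def nc_def)
  have X: "X \<in> carrier_mat nc nr" "A * X * A = A" "X * A * X = X"
      "mat_adjoint (A * X) = A * X" "mat_adjoint (X * A) = X * A"
    and Y: "Y \<in> carrier_mat nc nr" "A * Y * A = A" "Y * A * Y = Y"
      "mat_adjoint (A * Y) = A * Y" "mat_adjoint (Y * A) = Y * A"
    using assms by (auto simp: is_pseudo_inverse_def nr_def nc_def)
  note AX = mult_carrier_mat[OF A X(1)] and AY = mult_carrier_mat[OF A Y(1)]
    and XA = mult_carrier_mat[OF X(1) A] and YA = mult_carrier_mat[OF Y(1) A]
  have "A * X = (A * Y) * (A * X)"
    using assoc_mult_mat[OF AY A X(1)] Y(2) by simp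
  then have "A * X = mat_adjoint ((A * Y) * (A * X))"
    using X(4) by simp
  also have "\<dots> = (A * X) * (A * Y)"
    using mat_adjoint_mult[OF AY AX] X(4) Y(4) by simp
  also have "\<dots> = A * Y"
    using assoc_mult_mat[OF AX A Y(1)] X(2) by simp
  finally have 1: "A * X = A * Y" .
  have "X * A = (X * A) * (Y * A)"
    using assoc_mult_mat[OF X(1) AY A] assoc_mult_mat[OF X(1) A YA] assoc_mult_mat[OF A Y(1) A] Y(2) by simp
  then have "X * A = mat_adjoint ((X * A) * (Y * A))"
    using X(5) by simp
  also have "\<dots> = (Y * A) * (X * A)"
    using mat_adjoint_mult[OF XA YA] X(5) Y(5) by simp
  also have "\<dots> = Y * A"
    using assoc_mult_mat[OF Y(1) A XA] assoc_mult_mat[OF A X(1) A] X(2) by simp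
  finally have 2: "X * A = Y * A" .
  have "X = X * A * X" using X(3) by simp
  also have "\<dots> = Y * (A * X)" using 2 assoc_mult_mat[OF Y(1) A X(1)] by simp
  also have "\<dots> = Y" using 1 assoc_mult_mat[OF Y(1) A Y(1)] Y(3) by simp
  finally show ?thesis .
qed

lemma pseudo_inverse_eqI: "is_pseudo_inverse A X \<Longrightarrow> pseudo_inverse A = X"
  unfolding pseudo_inverse_def using is_pseudo_inverse_unique by blast

text \<open>For full column rank the Gram matrix is invertible and the pseudo-inverse is (B* B)^(-1)
  B*, a left inverse.\<close>

lemma is_pseudo_inverse_inj_mat:
  assumes inj: "inj_mat B" and B: "B \<in> carrier_mat nr nc"
  shows "is_pseudo_inverse B (pseudo_inverse B)" "pseudo_inverse B \<in> carrier_mat nc nr"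
    "pseudo_inverse B * B = 1\<^sub>m nc"
proof -
  define G where "G = mat_adjoint B * B"
  have aB: "mat_adjoint B \<in> carrier_mat nc nr" using B by simp
  have G: "G \<in> carrier_mat nc nc" unfolding G_def using mult_carrier_mat[OF aB B] .
  obtain K where K: "K \<in> carrier_mat nc nc" "K * G = 1\<^sub>m nc" "G * K = 1\<^sub>m nc"
    using inj_mat_square_inverse[OF G] inj_mat_gram[OF B inj] unfolding G_def by blast
  have aK: "mat_adjoint K \<in> carrier_mat nc nc" using K(1) by simp
  have adj_one: "mat_adjoint (1\<^sub>m nc) = (1\<^sub>m nc :: complex mat)" by (rule eq_matI) auto
  have "mat_adjoint G = G"
    unfolding G_def using mat_adjoint_mult[OF aB B] by simp
  \<comment> \<open>The adjoint of an inverse of the Hermitian \<open>G\<close> is again an inverse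
    of \<open>G\<close>, so \<open>K\<close> is Hermitian, as the symmetry of \<open>B * X\<close>
    requires.\<close>
  then have "mat_adjoint K * G = 1\<^sub>m nc"
    using mat_adjoint_mult[OF G K(1)] K(3) adj_one by simp
  then have "mat_adjoint K * (G * K) = K"
    using assoc_mult_mat[OF aK G K(1)] K(1) by simp
  then have Kh: "mat_adjoint K = K" using right_mult_one_mat[OF aK] K(3) by simp
  define X where "X = K * mat_adjoint B"
  have X: "X \<in> carrier_mat nc nr" unfolding X_def using K aB by simp
  have XB: "X * B = 1\<^sub>m nc"
    unfolding X_def using assoc_mult_mat[OF K(1) aB B] K(2) G_def by simp
  have "mat_adjoint X = B * K"
    unfolding X_def using mat_adjoint_mult[OF K(1) aB] Kh by simp
  then have "mat_adjoint (B * X) = B * X"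
    using mat_adjoint_mult[OF B X] assoc_mult_mat[OF B K(1) aB] X_def by simp
  moreover have "B * X * B = B" using assoc_mult_mat[OF B X B] XB B by simp
  moreover have "X * B * X = X" using XB X by simp
  ultimately have "is_pseudo_inverse B X"
    unfolding is_pseudo_inverse_def using B X XB adj_one by auto
  then show "is_pseudo_inverse B (pseudo_inverse B)" "pseudo_inverse B \<in> carrier_mat nc nr"
    "pseudo_inverse B * B = 1\<^sub>m nc"
    using pseudo_inverse_eqI[of B X] X XB by auto
qed

lemma is_pseudo_inverse_transpose:
  assumes "is_pseudo_inverse B X"
  shows "is_pseudo_inverse B\<^sup>T X\<^sup>T"
proof -
  define nr nc where "nr = dim_row B" and "nc = dim_col B"
  have B: "B \<in> carrier_mat nr nc" by (auto simp: nr_def nc_def)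
  have X: "X \<in> carrier_mat nc nr" "B * X * B = B" "X * B * X = X"
      "mat_adjoint (B * X) = B * X" "mat_adjoint (X * B) = X * B"
    using assms by (auto simp: is_pseudo_inverse_def nr_def nc_def)
  have BX: "(B * X)\<^sup>T = X\<^sup>T * B\<^sup>T" and XB: "(X * B)\<^sup>T = B\<^sup>T * X\<^sup>T"
    by (rule transpose_mult[OF B X(1)], rule transpose_mult[OF X(1) B])
  have Bt: "B\<^sup>T \<in> carrier_mat nc nr" and Xt: "X\<^sup>T \<in> carrier_mat nr nc" using B X by auto
  have "B\<^sup>T * X\<^sup>T * B\<^sup>T = (B * X * B)\<^sup>T"
    using transpose_mult[OF mult_carrier_mat[OF B X(1)] B] BX assoc_mult_mat[OF Bt Xt Bt] by simp
  moreover have "X\<^sup>T * B\<^sup>T * X\<^sup>T = (X * B * X)\<^sup>T"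
    using transpose_mult[OF mult_carrier_mat[OF X(1) B] X(1)] XB assoc_mult_mat[OF Xt Bt Xt] by simp
  ultimately show ?thesis
    unfolding is_pseudo_inverse_def
    using X B by (simp add: BX[symmetric] XB[symmetric] mat_adjoint_transpose)
qed

text \<open>\<open>B * X\<close> is Hermitian and idempotent, so |P y|^2 = <y, P y>, and
  Cauchy-Schwarz finishes.\<close>

lemma pseudo_inverse_projection_bound:
  assumes X: "is_pseudo_inverse B X" and B: "B \<in> carrier_mat nr nc" and y: "y \<in> carrier_vec nr"
  shows "vec_norm2 (B *\<^sub>v (X *\<^sub>v y)) \<le> vec_norm2 y"
proof -
  have Xc: "X \<in> carrier_mat nc nr" and BXB: "B * X * B = B" and h: "mat_adjoint (B * X) = B * X"
    using X B by (auto simp: is_pseudo_inverse_def)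
  define P where "P = B * X"
  have P: "P \<in> carrier_mat nr nr" unfolding P_def using B Xc by simp
  have PP: "P * P = P" unfolding P_def
    using assoc_mult_mat[OF mult_carrier_mat[OF B Xc] B Xc] BXB by simp
  have Py: "P *\<^sub>v y \<in> carrier_vec nr" using P y by simp
  have "P *\<^sub>v (P *\<^sub>v y) = P *\<^sub>v y" using assoc_mult_mat_vec[OF P P y] PP by simp
  then have "complex_of_real ((vec_norm2 (P *\<^sub>v y))\<^sup>2) = y \<bullet>c (P *\<^sub>v y)"
    using cscalar_prod_adjoint[OF P y Py] h by (simp add: P_def cscalar_prod_self)
  then have "(vec_norm2 (P *\<^sub>v y))\<^sup>2 = cmod (y \<bullet>c (P *\<^sub>v y))"
    by (metis norm_of_real abs_of_nonneg zero_le_power2)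
  also have "\<dots> \<le> vec_norm2 y * vec_norm2 (P *\<^sub>v y)"
    using P y by (intro cscalar_prod_cauchy_schwarz) auto
  finally have "vec_norm2 (P *\<^sub>v y) * vec_norm2 (P *\<^sub>v y) \<le> vec_norm2 y * vec_norm2 (P *\<^sub>v y)"
    by (simp add: power2_eq_square)
  then have "vec_norm2 (P *\<^sub>v y) \<le> vec_norm2 y"
    using vec_norm2_nonneg[of y] vec_norm2_nonneg[of "P *\<^sub>v y"]
    by (metis less_eq_real_def mult_right_le_imp_le)
  then show ?thesis unfolding P_def using B Xc y by simp
qed

text \<open>For \<open>u\<close> in the range and \<open>v\<close> in the kernel of \<open>P\<close>, exchanging the lengths of \<open>u\<close> and \<open>v\<close>
  does not change the norm of \<open>u + v\<close>, as the inner product is unaffected.\<close>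

lemma oblique_projection_complement_bound:
  assumes P: "P \<in> carrier_mat n n" and PP: "P * P = P" and t: "t \<ge> 1"
    and bound: "\<And>x. x \<in> carrier_vec n \<Longrightarrow> vec_norm2 (P *\<^sub>v x) \<le> t * vec_norm2 x"
    and x: "x \<in> carrier_vec n"
  shows "vec_norm2 (x - P *\<^sub>v x) \<le> t * vec_norm2 x"
proof -
  define u where "u = P *\<^sub>v x"
  define v where "v = x - u"
  have u: "u \<in> carrier_vec n" and v: "v \<in> carrier_vec n"
    using P x by (auto simp: u_def v_def)
  have Pu: "P *\<^sub>v u = u" unfolding u_def using assoc_mult_mat_vec[OF P P x] PP by simp
  have Pv: "P *\<^sub>v v = 0\<^sub>v n"
    unfolding v_def using mult_minus_distrib_mat_vec[OF P x u] Pu u by (simp add: u_def[symmetric])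
  have xuv: "x = u + v" unfolding v_def using x u by auto
  show ?thesis
  \<comment> \<open>Lengths can be exchanged only if both are nonzero. In the case u = 0 the vector
    is its own complement, and \<open>t \<ge> 1\<close> gives the claim.\<close>
  proof (cases "vec_norm2 u = 0 \<or> vec_norm2 v = 0")
    case True
    then show ?thesis
    proof
      assume "vec_norm2 u = 0"
      then have "u = 0\<^sub>v n" using u vec_norm2_eq_0_iff by blast
      then have "x = v" using xuv v by simp
      then show ?thesis using t mult_right_mono[of 1 t "vec_norm2 x"] v_def u_def by simp
    qed (use t in \<open>simp add: v_def u_def\<close>)
  next
    case False
    define a where "a = vec_norm2 u"
    define b where "b = vec_norm2 v"
    have ab: "a > 0" "b > 0"
      using False vec_norm2_nonneg[of u] vec_norm2_nonneg[of v] unfolding a_def b_def by linarith+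
    define u' where "u' = complex_of_real (b / a) \<cdot>\<^sub>v u"
    define v' where "v' = complex_of_real (a / b) \<cdot>\<^sub>v v"
    have uv': "u' \<in> carrier_vec n" "v' \<in> carrier_vec n" using u v by (auto simp: u'_def v'_def)
    have "(vec_norm2 (u' + v'))\<^sup>2 = (vec_norm2 (complex_of_real 1 \<cdot>\<^sub>v u + complex_of_real 1 \<cdot>\<^sub>v v))\<^sup>2"
      unfolding u'_def v'_def vec_norm2_power2_comb[OF u v]
      using ab by (simp add: a_def[symmetric] b_def[symmetric] power_divide)
    then have "vec_norm2 (u' + v') = vec_norm2 x"
      by (simp add: xuv)
    moreover have "P *\<^sub>v (u' + v') = u'"
    proof -
      have "P *\<^sub>v u' = u'" unfolding u'_def using mult_mat_vec[OF P u] Pu by simp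
      moreover have "P *\<^sub>v v' = 0\<^sub>v n" unfolding v'_def using mult_mat_vec[OF P v] unfolding Pv by auto
      ultimately show ?thesis using mult_add_distrib_mat_vec[OF P uv'] uv' by simp
    qed
    \<comment> \<open>The image of \<open>u' + v'\<close> thus has the length of \<open>v\<close>,
      while \<open>u' + v'\<close> itself is as long as \<open>x\<close>: the bound for
      \<open>P\<close> at this vector is the claim.\<close>
    moreover have "vec_norm2 u' = b"
      unfolding u'_def vec_norm2_smult using ab by (simp add: a_def norm_divide)
    ultimately show ?thesis
      using bound[of "u' + v'"] uv' by (simp add: b_def v_def u_def)
  qed
qed

section \<open>The smallest singular value\<close>

text \<open>With \<open>c\<close> the infimum of the Rayleigh quotient, \<open>H = B\<^sup>* B - c\<close> is positive semidefinite, so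
  \<open>(norm (H x))\<^sup>2 \<le> h \<langle>x, H x\<rangle>\<close> for any bound \<open>h\<close> of \<open>H\<close>. If \<open>H\<close> were invertible, this would
  push the infimum above \<open>c\<close>.\<close>

lemma smallest_gram_eigenvalue:
  fixes B :: "complex mat"
  assumes B: "B \<in> carrier_mat nr nc" and nc: "nc > 0"
  obtains c where "c \<ge> 0" "eigenvalue (mat_adjoint B * B) (complex_of_real c)"
    "\<And>x. x \<in> carrier_vec nc \<Longrightarrow> c * (vec_norm2 x)\<^sup>2 \<le> (vec_norm2 (B *\<^sub>v x))\<^sup>2"
proof -
  define G where "G = mat_adjoint B * B"
  have G: "G \<in> carrier_mat nc nc"
    unfolding G_def using mult_carrier_mat[OF mat_adjoint_carrier[OF B] B] .
  define S where "S = {(vec_norm2 (B *\<^sub>v x))\<^sup>2 | x. x \<in> carrier_vec nc \<and> vec_norm2 x = 1}"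
  define c where "c = Inf S"
  have "vec_norm2 (unit_vec nc 0) = 1"
  proof -
    have "(vec_norm2 (unit_vec nc 0))\<^sup>2 = (\<Sum>i<nc. if i = 0 then 1 else 0)"
      unfolding vec_norm2_power2 by (intro sum.cong) (use nc in auto)
    also have "\<dots> = 1" using nc by simp
    finally show ?thesis by (simp add: power2_eq_1_iff) (use vec_norm2_nonneg[of "unit_vec nc 0"] in linarith)
  qed
  then have S_ne: "S \<noteq> {}" unfolding S_def using unit_vec_carrier[of nc 0] by blast
  have S_bdd: "bdd_below S" unfolding S_def by (rule bdd_belowI[of _ 0]) auto
  have c0: "c \<ge> 0" unfolding c_def by (rule cInf_greatest[OF S_ne]) (auto simp: S_def)
  have cbound: "c * (vec_norm2 x)\<^sup>2 \<le> (vec_norm2 (B *\<^sub>v x))\<^sup>2" if x: "x \<in> carrier_vec nc" for x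
  proof (cases "x = 0\<^sub>v nc")
    case True
    then show ?thesis using B by simp
  next
    case False
    then have pos: "vec_norm2 x > 0" using x vec_norm2_pos_iff by blast
    define y where "y = complex_of_real (inverse (vec_norm2 x)) \<cdot>\<^sub>v x"
    have y: "y \<in> carrier_vec nc" "vec_norm2 y = 1"
      using x pos by (auto simp: y_def vec_norm2_smult norm_inverse)
    then have "c \<le> (vec_norm2 (B *\<^sub>v y))\<^sup>2"
      unfolding c_def by (intro cInf_lower S_bdd) (auto simp: S_def)
    also have "\<dots> = (vec_norm2 (B *\<^sub>v x))\<^sup>2 / (vec_norm2 x)\<^sup>2"
      unfolding y_def mult_mat_vec[OF B x] vec_norm2_smult using pos
      by (simp add: norm_inverse power_mult_distrib divide_inverse power_inverse mult.commute)
    finally show ?thesis using pos by (simp add: field_simps)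
  qed
  have "eigenvalue G (complex_of_real c)"
  proof (rule ccontr)
    assume no_ev: "\<not> eigenvalue G (complex_of_real c)"
    define H where "H = char_matrix G (complex_of_real c)"
    have H: "H \<in> carrier_mat nc nc" unfolding H_def using G by simp
    have Hx: "H *\<^sub>v x = G *\<^sub>v x - complex_of_real c \<cdot>\<^sub>v x" if x: "x \<in> carrier_vec nc" for x
    proof -
      have "H *\<^sub>v x = G *\<^sub>v x + ((- complex_of_real c) \<cdot>\<^sub>m 1\<^sub>m nc) *\<^sub>v x"
        unfolding H_def char_matrix_def using G x by (simp add: add_mult_distrib_mat_vec[of _ nc nc])
      also have "((- complex_of_real c) \<cdot>\<^sub>m 1\<^sub>m nc) *\<^sub>v x = - (complex_of_real c \<cdot>\<^sub>v x)"
        using x by (intro eq_vecI) auto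
      finally show ?thesis using G x by auto
    qed
    have "inj_mat H"
      using no_ev eigenvalue_char_matrix[OF G] by (intro inj_matI[OF H]) (auto simp: H_def)
    then obtain K where K: "K \<in> carrier_mat nc nc" "K * H = 1\<^sub>m nc"
      using inj_mat_square_inverse[OF H] by blast
    obtain h where h: "h > 0" "\<And>x. x \<in> carrier_vec nc \<Longrightarrow> vec_norm2 (H *\<^sub>v x) \<le> h * vec_norm2 x"
      using mult_mat_vec_bounded[of H] H by auto
    obtain k where k: "k > 0" "\<And>x. x \<in> carrier_vec nc \<Longrightarrow> vec_norm2 (K *\<^sub>v x) \<le> k * vec_norm2 x"
      using mult_mat_vec_bounded[of K] K by auto
    \<comment> \<open>This is the form <x, H x>, as \<open>form\<close> shows; the choice of
      \<open>c\<close> makes it nonnegative.\<close>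
    define q where "q x = (vec_norm2 (B *\<^sub>v x))\<^sup>2 - c * (vec_norm2 x)\<^sup>2" for x
    have q_nonneg: "q x \<ge> 0" if "x \<in> carrier_vec nc" for x
      using cbound[OF that] by (simp add: q_def)
    have form: "Re (w \<bullet>c (H *\<^sub>v x)) = Re ((B *\<^sub>v w) \<bullet>c (B *\<^sub>v x)) - c * Re (w \<bullet>c x)"
      if w: "w \<in> carrier_vec nc" and x: "x \<in> carrier_vec nc" for w x
    proof -
      have Gx: "G *\<^sub>v x \<in> carrier_vec nc" using G x by simp
      have "w \<bullet>c (H *\<^sub>v x) = w \<bullet>c (G *\<^sub>v x) - complex_of_real c * (w \<bullet>c x)"
        unfolding Hx[OF x] scalar_prod_def using w x Gx G
        by (simp add: sum_subtractf right_diff_distrib sum_distrib_left mult_ac)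
      then show ?thesis
        using gram_cscalar_prod[OF B w x] by (simp add: G_def)
    qed
    have key: "(vec_norm2 (H *\<^sub>v x))\<^sup>2 \<le> h * q x" if x: "x \<in> carrier_vec nc" for x
    proof -
      define w where "w = H *\<^sub>v x"
      have w: "w \<in> carrier_vec nc" unfolding w_def using H x by simp
      have Hw: "H *\<^sub>v w \<in> carrier_vec nc" using H w by simp
      have Bx: "B *\<^sub>v x \<in> carrier_vec nr" and Bw: "B *\<^sub>v w \<in> carrier_vec nr" using B x w by simp_all
      \<comment> \<open>A descent step x - s w changes \<open>q\<close> by at most - 2 s |w|^2 + s^2
        h |w|^2, which is smallest for s = 1 / h. As \<open>q\<close> stays nonnegative there, |w|^2
        / h <= q x.\<close>
      define y where "y = complex_of_real (- (1 / h)) \<cdot>\<^sub>v w + complex_of_real 1 \<cdot>\<^sub>v x"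
      have y: "y \<in> carrier_vec nc" unfolding y_def using w x by simp
      have By: "B *\<^sub>v y = complex_of_real (- (1 / h)) \<cdot>\<^sub>v (B *\<^sub>v w) + complex_of_real 1 \<cdot>\<^sub>v (B *\<^sub>v x)"
        unfolding y_def using B w x
        by (simp only: mult_add_distrib_mat_vec[OF B] mult_mat_vec[OF B] smult_carrier_vec)
      have ww: "Re ((B *\<^sub>v w) \<bullet>c (B *\<^sub>v x)) - c * Re (w \<bullet>c x) = (vec_norm2 w)\<^sup>2"
        using form[OF w x] by (simp add: w_def[symmetric] cscalar_prod_self del: of_real_power)
      have qw: "q w \<le> h * (vec_norm2 w)\<^sup>2"
      proof -
        have "q w = Re (w \<bullet>c (H *\<^sub>v w))"
          using form[OF w w] by (simp add: q_def cscalar_prod_self del: of_real_power)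
        also have "\<dots> \<le> cmod (w \<bullet>c (H *\<^sub>v w))" by (rule complex_Re_le_cmod)
        also have "\<dots> \<le> vec_norm2 w * vec_norm2 (H *\<^sub>v w)"
          using w Hw by (intro cscalar_prod_cauchy_schwarz) (simp only: carrier_vecD)
        also have "\<dots> \<le> vec_norm2 w * (h * vec_norm2 w)"
          by (intro mult_left_mono h w) auto
        finally show ?thesis by (simp add: power2_eq_square mult_ac)
      qed
      have "q y = q x + q w / h\<^sup>2 - 2 / h * (Re ((B *\<^sub>v w) \<bullet>c (B *\<^sub>v x)) - c * Re (w \<bullet>c x))"
        unfolding q_def By vec_norm2_power2_comb[OF Bw Bx]
        unfolding y_def vec_norm2_power2_comb[OF w x]
        by (simp add: power_divide algebra_simps diff_divide_distrib)
      then have "0 \<le> q x + q w / h\<^sup>2 - 2 / h * (vec_norm2 w)\<^sup>2"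
        using q_nonneg[OF y] ww by simp
      also have "\<dots> \<le> q x + (h * (vec_norm2 w)\<^sup>2) / h\<^sup>2 - 2 / h * (vec_norm2 w)\<^sup>2"
        using divide_right_mono[OF qw, of "h\<^sup>2"] by simp
      also have "\<dots> = q x - (vec_norm2 w)\<^sup>2 / h"
        using h by (simp add: power2_eq_square field_simps)
      finally show ?thesis using h by (simp add: w_def field_simps)
    qed
    \<comment> \<open>For a unit vector x = K (H x), so 1 <= k^2 |H x|^2 <= k^2 h q(x): every
      Rayleigh quotient exceeds \<open>c\<close> by a fixed amount.\<close>
    have "c + 1 / (k\<^sup>2 * h) \<le> Inf S"
    proof (rule cInf_greatest[OF S_ne])
      fix s assume "s \<in> S"
      then obtain x where x: "x \<in> carrier_vec nc" "vec_norm2 x = 1" and s: "s = (vec_norm2 (B *\<^sub>v x))\<^sup>2"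
        unfolding S_def by blast
      have Hxc: "H *\<^sub>v x \<in> carrier_vec nc" using H x by simp
      have "K *\<^sub>v (H *\<^sub>v x) = x" using assoc_mult_mat_vec[OF K(1) H x(1)] K(2) x by simp
      then have "1 \<le> k * vec_norm2 (H *\<^sub>v x)" using k(2)[OF Hxc] x by simp
      then have "1\<^sup>2 \<le> (k * vec_norm2 (H *\<^sub>v x))\<^sup>2" by (intro power_mono) auto
      also have "\<dots> \<le> k\<^sup>2 * (h * q x)"
        unfolding power_mult_distrib by (intro mult_left_mono key x) auto
      finally have "1 \<le> k\<^sup>2 * h * (s - c)" using x s by (simp add: q_def mult_ac)
      moreover have "k\<^sup>2 * h > 0" using h k by simp
      ultimately have "1 / (k\<^sup>2 * h) \<le> s - c"
        by (subst pos_divide_le_eq) (simp_all add: mult.commute)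
      then show "c + 1 / (k\<^sup>2 * h) \<le> s" by simp
    qed
    moreover have "1 / (k\<^sup>2 * h) > 0" using h k by simp
    ultimately show False unfolding c_def[symmetric] by linarith
  qed
  then show ?thesis using that[of c] c0 cbound unfolding G_def by blast
qed

text \<open>Squares of singular values are roots of a characteristic polynomial, and squaring is
  injective on nonnegative reals. Without finiteness \<open>Min\<close> in \<open>sigma_min\<close>
  would carry no information.\<close>

lemma finite_singular_values:
  "finite (singular_values A)"
proof -
  define G where "G = (if dim_col A \<le> dim_row A then mat_adjoint A * A else A * mat_adjoint A)"
  obtain n where G: "G \<in> carrier_mat n n"
  proof
    show "G \<in> carrier_mat (dim_row G) (dim_row G)" unfolding G_def by (auto intro!: carrier_matI)
  qed
  have "char_poly G \<noteq> 0" using degree_monic_char_poly[OF G] by auto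
  then have "finite {e. eigenvalue G e}"
    unfolding eigenvalue_root_char_poly[OF G] by (rule poly_roots_finite)
  moreover have "(\<lambda>s. complex_of_real (s\<^sup>2)) ` singular_values A \<subseteq> {e. eigenvalue G e}"
    by (auto simp: singular_values_def G_def)
  moreover have "inj_on (\<lambda>s. complex_of_real (s\<^sup>2)) (singular_values A)"
    by (rule inj_onI) (auto simp: singular_values_def of_real_eq_iff power2_eq_iff_nonneg simp del: of_real_power)
  ultimately show ?thesis by (meson finite_subset inj_on_finite)
qed

text \<open>Together these are the variational description of \<open>sigma_min\<close>, the only
  form in which it is used afterwards. The root of the Rayleigh infimum is a singular value, so the
  minimum cannot exceed it; an eigenvector for the minimum is stretched by exactly
  \<open>sigma_min B\<close>. The condition \<open>nc \<le> nr\<close> selects the Gram matrix B* B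
  in the definition.\<close>

lemma
  fixes B :: "complex mat"
  assumes B: "B \<in> carrier_mat nr nc" and nc: "0 < nc" "nc \<le> nr"
  shows sigma_min_mult_le: "x \<in> carrier_vec nc \<Longrightarrow> sigma_min B * vec_norm2 x \<le> vec_norm2 (B *\<^sub>v x)"
    and sigma_min_greatest:
      "(\<And>x. x \<in> carrier_vec nc \<Longrightarrow> a * vec_norm2 x \<le> vec_norm2 (B *\<^sub>v x)) \<Longrightarrow> a \<le> sigma_min B"
proof -
  have sv: "singular_values B = {s. s \<ge> 0 \<and> eigenvalue (mat_adjoint B * B) (complex_of_real (s\<^sup>2))}"
    using B nc by (simp add: singular_values_def)
  obtain c where c: "c \<ge> 0" "eigenvalue (mat_adjoint B * B) (complex_of_real c)"
    "\<And>x. x \<in> carrier_vec nc \<Longrightarrow> c * (vec_norm2 x)\<^sup>2 \<le> (vec_norm2 (B *\<^sub>v x))\<^sup>2"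
    using smallest_gram_eigenvalue[OF B nc(1)] by blast
  have sqc: "sqrt c \<in> singular_values B" using c by (simp add: sv del: of_real_power)
  show "sigma_min B * vec_norm2 x \<le> vec_norm2 (B *\<^sub>v x)" if x: "x \<in> carrier_vec nc"
  proof -
    have "sigma_min B * vec_norm2 x \<le> sqrt c * vec_norm2 x"
      unfolding sigma_min_def using sqc finite_singular_values by (intro mult_right_mono Min_le) auto
    also have "\<dots> \<le> vec_norm2 (B *\<^sub>v x)"
      by (rule power2_le_imp_le) (use c x in \<open>auto simp: power_mult_distrib\<close>)
    finally show ?thesis .
  qed
  show "a \<le> sigma_min B"
    if a: "\<And>x. x \<in> carrier_vec nc \<Longrightarrow> a * vec_norm2 x \<le> vec_norm2 (B *\<^sub>v x)"
  proof -
    have "sigma_min B \<in> singular_values B"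
      unfolding sigma_min_def using sqc finite_singular_values by (intro Min_in) auto
    then obtain v where s: "sigma_min B \<ge> 0"
      and v: "eigenvector (mat_adjoint B * B) v (complex_of_real ((sigma_min B)\<^sup>2))"
      unfolding sv eigenvalue_def by blast
    have vc: "v \<in> carrier_vec nc" "v \<noteq> 0\<^sub>v nc"
      and Gv: "(mat_adjoint B * B) *\<^sub>v v = complex_of_real ((sigma_min B)\<^sup>2) \<cdot>\<^sub>v v"
      using v B unfolding eigenvector_def by auto
    have "complex_of_real ((vec_norm2 (B *\<^sub>v v))\<^sup>2) = v \<bullet>c (complex_of_real ((sigma_min B)\<^sup>2) \<cdot>\<^sub>v v)"
      using gram_cscalar_prod[OF B vc(1) vc(1)] unfolding Gv by (simp add: cscalar_prod_self)
    also have "\<dots> = complex_of_real ((sigma_min B)\<^sup>2 * (vec_norm2 v)\<^sup>2)"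
      using vc by (simp add: conjugate_smult_vec cscalar_prod_self)
    finally have "vec_norm2 (B *\<^sub>v v) = sigma_min B * vec_norm2 v"
      using s unfolding of_real_eq_iff power_mult_distrib[symmetric]
      by (subst (asm) power2_eq_iff_nonneg) auto
    moreover have "vec_norm2 v > 0" using vc vec_norm2_pos_iff by blast
    ultimately show ?thesis using a[OF vc(1)] by simp
  qed
qed

section \<open>Pivoting, orthonormalisation and rank\<close>

text \<open>Gaussian elimination with complete pivoting: every row operation subtracts a multiple of the
  pivot row by a factor of modulus at most 1, so the constant does not depend on \<open>u\<close>.\<close>

lemma complete_pivoting:
  "\<exists>C\<ge>0. \<forall>S (u :: nat \<Rightarrow> nat \<Rightarrow> complex). finite S \<and> card S = s \<longrightarrow>
     (\<exists>I \<subseteq> {..<N}. card I \<le> s \<and> (\<forall>x. \<forall>l<N.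
        cmod (\<Sum>j\<in>S. u l j * x j) \<le> C * (\<Sum>i\<in>I. cmod (\<Sum>j\<in>S. u i j * x j))))"
proof (induction s)
  case 0
  show ?case
  proof (intro exI[of _ 0] conjI allI impI)
    fix S :: "nat set" and u :: "nat \<Rightarrow> nat \<Rightarrow> complex"
    assume "finite S \<and> card S = 0"
    then show "\<exists>I\<subseteq>{..<N}. card I \<le> 0 \<and> (\<forall>x. \<forall>l<N.
        cmod (\<Sum>j\<in>S. u l j * x j) \<le> 0 * (\<Sum>i\<in>I. cmod (\<Sum>j\<in>S. u i j * x j)))"
      by (intro exI[of _ "{}"]) auto
  qed simp
next
  case (Suc s)
  then obtain C where C: "C \<ge> 0" and IH: "\<And>S (u :: nat \<Rightarrow> nat \<Rightarrow> complex). finite S \<Longrightarrow> card S = s \<Longrightarrow>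
     \<exists>I \<subseteq> {..<N}. card I \<le> s \<and> (\<forall>x. \<forall>l<N.
        cmod (\<Sum>j\<in>S. u l j * x j) \<le> C * (\<Sum>i\<in>I. cmod (\<Sum>j\<in>S. u i j * x j)))"
    by auto
  \<comment> \<open>It must dominate \<open>C\<close>, the factor of the other selected rows, and
    \<open>C * real s + 1\<close>, the factor collected by the pivot row.\<close>
  define C' where "C' = C * (1 + real s) + 1"
  have C': "C' \<ge> 0" "C \<le> C'" "C * real s + 1 \<le> C'"
    using C by (auto simp: C'_def algebra_simps)
  show ?case
  proof (intro exI[of _ C'] conjI allI impI C')
    fix S :: "nat set" and u :: "nat \<Rightarrow> nat \<Rightarrow> complex"
    assume S: "finite S \<and> card S = Suc s"
    define f where "f x l = (\<Sum>j\<in>S. u l j * x j)" for x l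
    show "\<exists>I\<subseteq>{..<N}. card I \<le> Suc s \<and> (\<forall>x. \<forall>l<N.
        cmod (\<Sum>j\<in>S. u l j * x j) \<le> C' * (\<Sum>i\<in>I. cmod (\<Sum>j\<in>S. u i j * x j)))"
    proof (cases "\<forall>l<N. \<forall>j\<in>S. u l j = 0")
      case True
      then show ?thesis by (intro exI[of _ "{}"]) auto
    next
      case False
      define E where "E = (\<lambda>(l, j). cmod (u l j)) ` ({..<N} \<times> S)"
      have E: "finite E" "E \<noteq> {}" using S False by (auto simp: E_def)
      obtain i j0 where i: "i < N" and j0: "j0 \<in> S" and max: "cmod (u i j0) = Max E"
        using Max_in[OF E] by (auto simp: E_def)
      have pivot: "cmod (u l j) \<le> cmod (u i j0)" if "l < N" "j \<in> S" for l j
        unfolding max using that E by (intro Max_ge) (auto simp: E_def)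
      have nz: "u i j0 \<noteq> 0" using False pivot by fastforce
      define \<rho> where "\<rho> l = u l j0 / u i j0" for l
      have \<rho>: "cmod (\<rho> l) \<le> 1" if "l < N" for l
        using pivot[OF that j0] nz by (simp add: \<rho>_def norm_divide)
      define u' where "u' l j = u l j - \<rho> l * u i j" for l j
      have f': "(\<Sum>j\<in>S - {j0}. u' l j * x j) = f x l - \<rho> l * f x i" for x l
      proof -
        have "(\<Sum>j\<in>S - {j0}. u' l j * x j) = (\<Sum>j\<in>S. u' l j * x j)"
          using S j0 nz by (subst sum.remove[of S j0]) (auto simp: u'_def \<rho>_def)
        also have "\<dots> = f x l - \<rho> l * f x i"
          by (simp add: f_def u'_def left_diff_distrib sum_subtractf sum_distrib_left mult.assoc)
        finally show ?thesis .
      qed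
      \<comment> \<open>The pivot column of \<open>u'\<close> vanishes, so the induction hypothesis
        is applied to the remaining columns. Indexing columns by a set makes renumbering
        unnecessary.\<close>
      have "finite (S - {j0})" "card (S - {j0}) = s" using S j0 by auto
      from IH[OF this, of u', unfolded f'] obtain I where I: "I \<subseteq> {..<N}" "card I \<le> s"
        and bound: "\<And>x l. l < N \<Longrightarrow>
          cmod (f x l - \<rho> l * f x i) \<le> C * (\<Sum>k\<in>I. cmod (f x k - \<rho> k * f x i))"
        by blast
      have finI: "finite I" using I finite_subset by blast
      have \<rho>i: "\<rho> i = 1" using nz by (simp add: \<rho>_def)
      have "cmod (f x l) \<le> C' * (\<Sum>k\<in>insert i I. cmod (f x k))" if l: "l < N" for x l
      proof -
        \<comment> \<open>The recursive choice may contain the pivot row again; its reduced row is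
          zero, so that term drops out.\<close>
        have "(\<Sum>k\<in>I. cmod (f x k - \<rho> k * f x i)) = (\<Sum>k\<in>I - {i}. cmod (f x k - \<rho> k * f x i))"
          by (rule sum.mono_neutral_right) (use finI \<rho>i in auto)
        also have "\<dots> \<le> (\<Sum>k\<in>I - {i}. cmod (f x k) + cmod (f x i))"
        proof (rule sum_mono)
          fix k assume "k \<in> I - {i}"
          then have "k < N" using I by auto
          have "cmod (f x k - \<rho> k * f x i) \<le> cmod (f x k) + cmod (\<rho> k) * cmod (f x i)"
            by (metis norm_triangle_ineq4 norm_mult)
          also have "\<dots> \<le> cmod (f x k) + 1 * cmod (f x i)"
            by (intro add_left_mono mult_right_mono \<rho>[OF \<open>k < N\<close>]) auto
          finally show "cmod (f x k - \<rho> k * f x i) \<le> cmod (f x k) + cmod (f x i)" by simp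
        qed
        also have "\<dots> = (\<Sum>k\<in>I - {i}. cmod (f x k)) + real (card (I - {i})) * cmod (f x i)"
          by (simp add: sum.distrib)
        also have "\<dots> \<le> (\<Sum>k\<in>I - {i}. cmod (f x k)) + real s * cmod (f x i)"
          using I card_Diff1_le[of I i] by (intro add_left_mono mult_right_mono) auto
        finally have le: "(\<Sum>k\<in>I. cmod (f x k - \<rho> k * f x i))
          \<le> (\<Sum>k\<in>I - {i}. cmod (f x k)) + real s * cmod (f x i)" .
        have "cmod (f x l) \<le> cmod (f x l - \<rho> l * f x i) + cmod (\<rho> l * f x i)"
          by (metis diff_add_cancel norm_triangle_ineq)
        also have "\<dots> \<le> C * (\<Sum>k\<in>I. cmod (f x k - \<rho> k * f x i)) + 1 * cmod (f x i)"
          unfolding norm_mult by (intro add_mono bound l mult_right_mono \<rho>) auto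
        also have "\<dots> \<le> C * ((\<Sum>k\<in>I - {i}. cmod (f x k)) + real s * cmod (f x i)) + cmod (f x i)"
          using mult_left_mono[OF le C] by simp
        also have "\<dots> = C * (\<Sum>k\<in>I - {i}. cmod (f x k)) + (C * real s + 1) * cmod (f x i)"
          by (simp add: algebra_simps)
        also have "\<dots> \<le> C' * (\<Sum>k\<in>I - {i}. cmod (f x k)) + C' * cmod (f x i)"
          by (intro add_mono mult_right_mono C' sum_nonneg) auto
        also have "\<dots> = C' * (\<Sum>k\<in>insert i I. cmod (f x k))"
          using finI by (simp add: sum.insert_remove algebra_simps)
        finally show ?thesis .
      qed
      moreover have "insert i I \<subseteq> {..<N}" "card (insert i I) \<le> Suc s"
        using I i finI by (auto simp: card_insert_if)
      ultimately show ?thesis unfolding f_def by (intro exI[of _ "insert i I"]) auto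
    qed
  qed
qed

text \<open>Coefficient vectors orthonormal for the inner product <Z x, Z y>. The next one solves k
  < r homogeneous equations in r unknowns and is then normalised; injectivity of \<open>Z\<close>
  makes its length nonzero.\<close>

lemma gram_orthonormal_family:
  assumes Z: "Z \<in> carrier_mat N r" and inj: "inj_mat Z"
  shows "k \<le> r \<Longrightarrow> \<exists>s. (\<forall>i<k. s i \<in> carrier_vec r) \<and>
    (\<forall>i<k. \<forall>j<k. (Z *\<^sub>v s i) \<bullet>c (Z *\<^sub>v s j) = (if i = j then 1 else 0))"
proof (induction k)
  case (Suc k)
  then obtain s where s: "\<And>i. i < k \<Longrightarrow> s i \<in> carrier_vec r"
    and orth: "\<And>i j. i < k \<Longrightarrow> j < k \<Longrightarrow> (Z *\<^sub>v s i) \<bullet>c (Z *\<^sub>v s j) = (if i = j then 1 else 0)"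
    by auto
  define G where "G = mat_adjoint Z * Z"
  have G: "G \<in> carrier_mat r r"
    unfolding G_def using mult_carrier_mat[OF mat_adjoint_carrier[OF Z] Z] .
  define c where "c i = (if i < k then conjugate (G *\<^sub>v s i) else 0\<^sub>v r)" for i
  have c: "c i \<in> carrier_vec r" for i using G s by (auto simp: c_def)
  \<comment> \<open>The orthogonality conditions fill the rows below \<open>k\<close>. Row
    \<open>k\<close> exists because \<open>Suc k \<le> r\<close>, and being zero it makes the square
    matrix singular.\<close>
  define M where "M = mat\<^sub>r r r (\<lambda>i. if i = k then 0\<^sub>v r else c i)"
  have M: "M \<in> carrier_mat r r" by (simp add: M_def)
  have "det M = 0" unfolding M_def by (rule det_row_0) (use Suc c in auto)
  then obtain x where x: "x \<in> carrier_vec r" "x \<noteq> 0\<^sub>v r" "M *\<^sub>v x = 0\<^sub>v r"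
    using det_0_iff_vec_prod_zero_field[OF M] by blast
  have ortho_x: "(Z *\<^sub>v x) \<bullet>c (Z *\<^sub>v s i) = 0" if i: "i < k" for i
  proof -
    have ir: "i < r" using i Suc.prems by simp
    have "row M i = c i" using i ir c[of i] by (intro eq_vecI) (auto simp: M_def)
    then have "(M *\<^sub>v x) $ i = conjugate (G *\<^sub>v s i) \<bullet> x" using i ir M by (simp add: c_def)
    also have "\<dots> = x \<bullet>c (G *\<^sub>v s i)"
      using G s[OF i] x(1) by (intro comm_scalar_prod[of _ r]) auto
    also have "\<dots> = (Z *\<^sub>v x) \<bullet>c (Z *\<^sub>v s i)"
      unfolding G_def by (rule gram_cscalar_prod[OF Z x(1) s[OF i]])
    finally show ?thesis using x ir by simp
  qed
  have Zx: "Z *\<^sub>v x \<in> carrier_vec N" using Z x by simp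
  have "Z *\<^sub>v x \<noteq> 0\<^sub>v N" using inj_matD[OF inj Z x(1)] x(2) by blast
  then have pos: "vec_norm2 (Z *\<^sub>v x) > 0" using vec_norm2_pos_iff[OF Zx] by simp
  define a where "a = complex_of_real (inverse (vec_norm2 (Z *\<^sub>v x)))"
  define y where "y = a \<cdot>\<^sub>v x"
  have y: "y \<in> carrier_vec r" and Zy: "Z *\<^sub>v y = a \<cdot>\<^sub>v (Z *\<^sub>v x)"
    using x(1) mult_mat_vec[OF Z x(1)] by (auto simp: y_def)
  have Zs: "Z *\<^sub>v s i \<in> carrier_vec N" if "i < k" for i using Z s[OF that] by simp
  have "vec_norm2 (Z *\<^sub>v y) = 1"
    unfolding Zy vec_norm2_smult a_def using pos by (simp add: norm_inverse)
  then have yy: "(Z *\<^sub>v y) \<bullet>c (Z *\<^sub>v y) = 1" by (simp add: cscalar_prod_self)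
  have ys: "(Z *\<^sub>v y) \<bullet>c (Z *\<^sub>v s i) = 0" if i: "i < k" for i
    unfolding Zy using ortho_x[OF i] Zx Zs[OF i] by simp
  have sy: "(Z *\<^sub>v s i) \<bullet>c (Z *\<^sub>v y) = 0" if i: "i < k" for i
  proof -
    have "(Z *\<^sub>v s i) \<bullet>c (Z *\<^sub>v y) = conjugate ((Z *\<^sub>v y) \<bullet>c (Z *\<^sub>v s i))"
      using Zs[OF i] Zx unfolding Zy
      by (subst conjugate_sprod_vec[of _ N]) (auto intro!: comm_scalar_prod[of _ N])
    then show ?thesis using ys[OF i] by simp
  qed
  show ?case
  proof (intro exI[of _ "s(k := y)"] conjI allI impI)
    fix i j assume "i < Suc k" "j < Suc k"
    then show "(Z *\<^sub>v (s(k := y)) i) \<bullet>c (Z *\<^sub>v (s(k := y)) j) = (if i = j then 1 else 0)"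
      using orth[of i j] yy ys[of j] sy[of i] by (cases "i = k"; cases "j = k") auto
  qed (use s y in \<open>auto simp: less_Suc_eq\<close>)
qed simp

text \<open>With the coefficient vectors as columns of \<open>S\<close>, put Q = Z S. Then (Q* Z) S
  = Q* Q = 1, so T = Q* Z is the inverse of \<open>S\<close>. Triangularity of \<open>T\<close> is
  not claimed.\<close>

lemma qr_decomposition:
  assumes Z: "Z \<in> carrier_mat N r" and inj: "inj_mat Z"
  obtains Q T where "Q \<in> orthonormal_column_mats N r" "T \<in> carrier_mat r r" "Z = Q * T"
proof -
  obtain s where s: "\<And>i. i < r \<Longrightarrow> s i \<in> carrier_vec r"
    and orth: "\<And>i j. i < r \<Longrightarrow> j < r \<Longrightarrow> (Z *\<^sub>v s i) \<bullet>c (Z *\<^sub>v s j) = (if i = j then 1 else 0)"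
    using gram_orthonormal_family[OF Z inj, of r] by auto
  define S where "S = mat r r (\<lambda>(i, j). s j $ i)"
  have S: "S \<in> carrier_mat r r" by (simp add: S_def)
  have colS: "col S j = s j" if "j < r" for j
    using s[OF that] that by (intro eq_vecI) (auto simp: S_def)
  define Q where "Q = Z * S"
  have Q: "Q \<in> carrier_mat N r" unfolding Q_def using Z S by simp
  have aQ: "mat_adjoint Q \<in> carrier_mat r N" using Q by simp
  have colQ: "col Q j = Z *\<^sub>v s j" if "j < r" for j
    unfolding Q_def using col_mult2[OF Z S that] colS[OF that] by simp
  have QQ: "mat_adjoint Q * Q = 1\<^sub>m r"
  proof (rule eq_matI)
    fix i j assume ij: "i < dim_row (1\<^sub>m r)" "j < dim_col (1\<^sub>m r)"
    have Zs: "Z *\<^sub>v s i \<in> carrier_vec N" "Z *\<^sub>v s j \<in> carrier_vec N" using Z s ij by auto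
    have "row (mat_adjoint Q) i = conjugate (col Q i)"
      using Q ij by (intro eq_vecI) auto
    then have "(mat_adjoint Q * Q) $$ (i, j) = conjugate (Z *\<^sub>v s i) \<bullet> (Z *\<^sub>v s j)"
      using Q ij colQ by simp
    also have "\<dots> = (Z *\<^sub>v s j) \<bullet>c (Z *\<^sub>v s i)"
      using Zs by (intro comm_scalar_prod[of _ N]) auto
    finally show "(mat_adjoint Q * Q) $$ (i, j) = 1\<^sub>m r $$ (i, j)"
      using orth[of j i] ij by simp
  qed (use Q in auto)
  define T where "T = mat_adjoint Q * Z"
  have T: "T \<in> carrier_mat r r" unfolding T_def using mult_carrier_mat[OF aQ Z] .
  have "T * S = 1\<^sub>m r" unfolding T_def using assoc_mult_mat[OF aQ Z S] QQ by (simp add: Q_def)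
  then have "S * T = 1\<^sub>m r" by (rule mat_mult_left_right_inverse[OF T S])
  then have "Q * T = Z" unfolding Q_def using assoc_mult_mat[OF Z S T] Z by simp
  then show ?thesis using that[of Q T] Q QQ T by (auto simp: orthonormal_column_mats_def)
qed

text \<open>The bridge from rank to kernels: \<open>E\<close> is the 0/1 matrix that picks a maximal
  independent set of columns, whose size is the rank.\<close>

lemma rank_injective_column_selection:
  fixes X :: "complex mat"
  assumes X: "X \<in> carrier_mat N M" and rank: "vec_space.rank N X = r"
  obtains E where "E \<in> carrier_mat M r" "inj_mat (X * E)"
proof -
  interpret vec_space "TYPE(complex)" N .
  have fin: "finite (set (cols X))" by simp
  obtain U where max: "maximal U (\<lambda>T. T \<subseteq> set (cols X) \<and> lin_indpt T)"
    using maximal_exists_superset[OF fin, of "\<lambda>T. T \<subseteq> set (cols X) \<and> lin_indpt T" "{}"]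
      finite_lin_indpt2[of "{}"] by auto
  have U: "U \<subseteq> set (cols X)" "lin_indpt U" using max by (auto simp: maximal_def)
  have card: "card U = r" using rank_card_indpt[OF X max] rank by simp
  obtain ws where ws: "set ws = U" "distinct ws"
    using finite_distinct_list[OF finite_subset[OF U(1) fin]] by blast
  have len: "length ws = r" using distinct_card[OF ws(2)] ws card by simp
  have "\<forall>i<r. \<exists>a<M. ws ! i = col X a"
  proof (intro allI impI)
    fix i assume "i < r"
    then have "ws ! i \<in> set (cols X)" using U ws len nth_mem by blast
    then show "\<exists>a<M. ws ! i = col X a" using X by (auto simp: cols_def)
  qed
  then obtain a where a: "\<And>i. i < r \<Longrightarrow> a i < M" "\<And>i. i < r \<Longrightarrow> ws ! i = col X (a i)"
    by metis
  define E :: "complex mat" where "E = mat M r (\<lambda>(b, i). unit_vec M (a i) $ b)"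
  have E: "E \<in> carrier_mat M r" by (simp add: E_def)
  have XE: "X * E \<in> carrier_mat N r" using X E by simp
  have "col (X * E) i = ws ! i" if "i < r" for i
  proof -
    have "col E i = unit_vec M (a i)" using that by (intro eq_vecI) (auto simp: E_def)
    then have "col (X * E) i = X *\<^sub>v unit_vec M (a i)" using col_mult2[OF X E that] by simp
    then show ?thesis using a[OF that] X by (intro eq_vecI) auto
  qed
  then have cols: "cols (X * E) = ws" using XE len by (intro nth_equalityI) auto
  have "inj_mat (X * E)"
  proof (rule inj_matI[OF XE], rule ccontr)
    fix x assume "x \<in> carrier_vec r" "(X * E) *\<^sub>v x = 0\<^sub>v N" "x \<noteq> 0\<^sub>v r"
    then have "lin_dep (set (cols (X * E)))" using lin_depI[OF XE] cols ws by auto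
    then show False using U ws cols by simp
  qed
  then show ?thesis using that E by blast
qed

text \<open>For a column choice \<open>E\<close> of the product, \<open>V * E\<close> is square and
  injective, hence invertible. Every x is then (V E) z for some z, and B x = 0 becomes (B V E) z =
  0, which forces z = 0.\<close>

lemma full_rank_factor_inj:
  fixes B :: "complex mat"
  assumes B: "B \<in> carrier_mat N r" and V: "V \<in> carrier_mat r M" and rank: "vec_space.rank N (B * V) = r"
  shows "inj_mat B"
proof -
  have BV: "B * V \<in> carrier_mat N M" using B V by simp
  obtain E where E: "E \<in> carrier_mat M r" and inj: "inj_mat (B * V * E)"
    using rank_injective_column_selection[OF BV rank] by blast
  have VE: "V * E \<in> carrier_mat r r" using V E by simp
  have assoc: "B * V * E = B * (V * E)" using B V E by (rule assoc_mult_mat)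
  have injVE: "inj_mat (V * E)" using inj inj_mat_mult_leftD[OF _ B VE] unfolding assoc by blast
  then obtain K where K: "K \<in> carrier_mat r r" "(V * E) * K = 1\<^sub>m r"
    using inj_mat_square_inverse[OF VE] by blast
  show ?thesis
  proof (rule inj_matI[OF B])
    fix x assume x: "x \<in> carrier_vec r" "B *\<^sub>v x = 0\<^sub>v N"
    have Kx: "K *\<^sub>v x \<in> carrier_vec r" using K x by simp
    have VEKx: "(V * E) *\<^sub>v (K *\<^sub>v x) = x" using assoc_mult_mat_vec[OF VE K(1) x(1)] K(2) x by simp
    then have "(B * V * E) *\<^sub>v (K *\<^sub>v x) = 0\<^sub>v N"
      unfolding assoc using assoc_mult_mat_vec[OF B VE Kx] x by simp
    then have "K *\<^sub>v x = 0\<^sub>v r" using inj_matD[OF inj mult_carrier_mat[OF BV E] Kx] by simp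
    then show "x = 0\<^sub>v r" using VEKx VE by simp
  qed
qed

text \<open>Some \<open>R * E\<close> is invertible with inverse \<open>K\<close>; transposing (R E)
  K = 1 exhibits a left inverse of \<open>R\<^sup>T\<close>.\<close>

lemma full_row_rank_transpose_inj:
  fixes R :: "complex mat"
  assumes R: "R \<in> carrier_mat n M" and rank: "vec_space.rank n R = n"
  shows "inj_mat R\<^sup>T"
proof -
  obtain E where E: "E \<in> carrier_mat M n" and inj: "inj_mat (R * E)"
    using rank_injective_column_selection[OF R rank] by blast
  have RE: "R * E \<in> carrier_mat n n" and Rt: "R\<^sup>T \<in> carrier_mat M n" and Et: "E\<^sup>T \<in> carrier_mat n M"
    using R E by simp_all
  obtain K where K: "K \<in> carrier_mat n n" "(R * E) * K = 1\<^sub>m n"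
    using inj_mat_square_inverse[OF RE inj] by blast
  have Kt: "K\<^sup>T \<in> carrier_mat n n" using K by simp
  have "K\<^sup>T * (E\<^sup>T * R\<^sup>T) = 1\<^sub>m n"
    using transpose_mult[OF RE K(1)] transpose_mult[OF R E] K(2) by simp
  then have "(K\<^sup>T * E\<^sup>T) * R\<^sup>T = 1\<^sub>m n" using assoc_mult_mat[OF Kt Et Rt] by simp
  then show ?thesis
    using inj_mat_left_inverse[OF mult_carrier_mat[OF Kt Et] Rt] by simp
qed

section \<open>Row selection\<close>

text \<open>The coordinate selection as a matrix, so that picking rows becomes a left multiplication
  and associativity moves it through products.\<close>

definition selection_mat :: "nat \<Rightarrow> nat set \<Rightarrow> complex mat" where
  "selection_mat N I = mat (card I) N (\<lambda>(i, j). unit_vec N (pick I i) $ j)"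

lemma selection_mat_carrier [simp]: "selection_mat N I \<in> carrier_mat (card I) N"
  by (simp add: selection_mat_def)

lemma dim_selection_mat [simp]:
  "dim_row (selection_mat N I) = card I" "dim_col (selection_mat N I) = N"
  by (simp_all add: selection_mat_def)

lemma pick_less: "I \<subseteq> {..<N} \<Longrightarrow> i < card I \<Longrightarrow> pick I i < N"
  using pick_in_set_le[of i I] by auto

lemma bij_betw_pick:
  assumes "finite I"
  shows "bij_betw (pick I) {..<card I} I"
proof -
  have inj: "inj_on (pick I) {..<card I}"
    by (rule linorder_inj_onI') (use pick_mono_le in fastforce)
  moreover have "pick I ` {..<card I} \<subseteq> I" using pick_in_set_le by auto
  ultimately have "pick I ` {..<card I} = I"
    using card_image[OF inj] assms by (intro card_subset_eq) auto
  with inj show ?thesis by (simp add: bij_betw_def)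
qed

lemma selected_indices:
  assumes "I \<subseteq> {..<N}"
  shows "{i. i < N \<and> i \<in> I} = I"
  using assms by auto

lemma row_selection_mat:
  "i < card I \<Longrightarrow> row (selection_mat N I) i = unit_vec N (pick I i)"
  by (rule eq_vecI) (auto simp: selection_mat_def)

lemma select_rows_carrier:
  assumes "X \<in> carrier_mat N q" "I \<subseteq> {..<N}"
  shows "select_rows X I \<in> carrier_mat (card I) q"
  using assms by (auto simp: select_rows_def dim_submatrix selected_indices)

lemma select_rows_index:
  assumes "X \<in> carrier_mat N q" "I \<subseteq> {..<N}" "i < card I" "j < q"
  shows "select_rows X I $$ (i, j) = X $$ (pick I i, j)"
  using assms by (simp add: select_rows_def submatrix_def selected_indices pick_UNIV)

lemma select_rows_eq_mult:
  assumes "X \<in> carrier_mat N q" "I \<subseteq> {..<N}"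
  shows "select_rows X I = selection_mat N I * X"
proof (rule eq_matI)
  fix i j assume ij: "i < dim_row (selection_mat N I * X)" "j < dim_col (selection_mat N I * X)"
  then have i: "i < card I" and j: "j < q" using assms by (auto simp: selection_mat_def)
  have "(selection_mat N I * X) $$ (i, j) = row (selection_mat N I) i \<bullet> col X j"
    using ij by simp
  also have "\<dots> = X $$ (pick I i, j)"
    using i j assms pick_less[OF assms(2) i]
    by (simp add: row_selection_mat scalar_prod_left_unit[of _ N])
  finally show "select_rows X I $$ (i, j) = (selection_mat N I * X) $$ (i, j)"
    using select_rows_index[OF assms i j] by simp
qed (use select_rows_carrier[OF assms] assms in \<open>auto simp: selection_mat_def\<close>)

lemma vec_norm2_selection_mat:
  assumes x: "x \<in> carrier_vec N" and I: "I \<subseteq> {..<N}"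
  shows "(vec_norm2 (selection_mat N I *\<^sub>v x))\<^sup>2 = (\<Sum>i\<in>I. (cmod (x $ i))\<^sup>2)"
proof -
  have "finite I" using I finite_subset by blast
  have "(selection_mat N I *\<^sub>v x) $ i = x $ pick I i" if "i < card I" for i
    using that x pick_less[OF I that]
    by (simp add: row_selection_mat scalar_prod_left_unit[of _ N])
  then have "(vec_norm2 (selection_mat N I *\<^sub>v x))\<^sup>2 = (\<Sum>i<card I. (cmod (x $ pick I i))\<^sup>2)"
    unfolding vec_norm2_power2 by (intro sum.cong) (auto simp: selection_mat_def)
  also have "\<dots> = (\<Sum>i\<in>I. (cmod (x $ i))\<^sup>2)"
    by (rule sum.reindex_bij_betw[OF bij_betw_pick[OF \<open>finite I\<close>]])
  finally show ?thesis .
qed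

lemma vec_norm2_selection_mat_le:
  assumes "x \<in> carrier_vec N" "I \<subseteq> {..<N}"
  shows "vec_norm2 (selection_mat N I *\<^sub>v x) \<le> vec_norm2 x"
proof (rule power2_le_imp_le)
  show "(vec_norm2 (selection_mat N I *\<^sub>v x))\<^sup>2 \<le> (vec_norm2 x)\<^sup>2"
    unfolding vec_norm2_selection_mat[OF assms] unfolding vec_norm2_power2
    using assms by (intro sum_mono2) auto
qed simp

section \<open>Column selections as transposed row selections\<close>

lemma select_cols_eq_transpose:
  assumes A: "A \<in> carrier_mat N M" and J: "J \<subseteq> {..<M}"
  shows "select_cols A J = (select_rows A\<^sup>T J)\<^sup>T"
  using assms pick_less[OF J]
  by (intro eq_matI) (auto simp: select_cols_def select_rows_def submatrix_def selected_indices pick_UNIV)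

lemma submatrix_eq_transpose:
  assumes A: "A \<in> carrier_mat N M" and I: "I \<subseteq> {..<N}" and J: "J \<subseteq> {..<M}"
  shows "submatrix A I J = (select_rows (select_rows A I)\<^sup>T J)\<^sup>T"
  using assms pick_less[OF J] pick_less[OF I]
  by (intro eq_matI) (auto simp: select_rows_def submatrix_def selected_indices pick_UNIV)

lemma row_mult_eq_transpose_mult_vec:
  fixes W B :: "complex mat"
  assumes "W \<in> carrier_mat nr k" "B \<in> carrier_mat k q" "i < nr"
  shows "row (W * B) i = B\<^sup>T *\<^sub>v row W i"
  by (rule eq_vecI) (use assms in \<open>auto intro!: comm_scalar_prod[of _ k]\<close>)

text \<open>Stacking the coefficient vectors of all rows turns the span condition into one matrix
  equation. It transfers injectivity to the selected rows, and conversely certifies a competitor by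
  exhibiting \<open>W\<close>.\<close>

lemma basis_rows_iff:
  fixes B :: "complex mat"
  assumes B: "B \<in> carrier_mat N q"
  shows "basis_rows B k I \<longleftrightarrow>
    I \<subseteq> {..<N} \<and> card I = k \<and> (\<exists>W \<in> carrier_mat N k. W * select_rows B I = B)"
proof (cases "I \<subseteq> {..<N} \<and> card I = k")
  case True
  then have I: "I \<subseteq> {..<N}" and k: "card I = k" by auto
  let ?B = "select_rows B I"
  have Bh: "?B \<in> carrier_mat k q" using select_rows_carrier[OF B I] k by simp
  have space: "vec_space.row_space q ?B = {w \<in> carrier_vec q. \<exists>y \<in> carrier_vec k. ?B\<^sup>T *\<^sub>v y = w}"
    using vec_space.row_space_eq[OF Bh] Bh by simp
  have iff: "basis_rows B k I \<longleftrightarrow> (\<forall>i \<in> {..<N} - I. \<exists>y \<in> carrier_vec k. ?B\<^sup>T *\<^sub>v y = row B i)"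
    using B I k unfolding basis_rows_def by (auto simp: space)
  show ?thesis
  proof
    assume "basis_rows B k I"
    have "\<exists>y. y \<in> carrier_vec k \<and> ?B\<^sup>T *\<^sub>v y = row B i" if i: "i < N" for i
    proof (cases "i \<in> I")
      case True
      then obtain a where a: "a < k" "i = pick I a"
        using bij_betw_pick[OF finite_subset[OF I]] k by (auto simp: bij_betw_def)
      \<comment> \<open>The definition speaks only of unselected rows; a selected row is reproduced
        by a unit vector.\<close>
      have "?B\<^sup>T *\<^sub>v unit_vec k a = row B i"
        using Bh a i B by (intro eq_vecI) (auto simp: select_rows_index[OF B I] k)
      then show ?thesis using unit_vec_carrier by blast
    qed (use \<open>basis_rows B k I\<close> i iff in auto)
    then obtain y where y: "\<And>i. i < N \<Longrightarrow> y i \<in> carrier_vec k"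
      "\<And>i. i < N \<Longrightarrow> ?B\<^sup>T *\<^sub>v y i = row B i"
      by metis
    define W where "W = mat N k (\<lambda>(i, j). y i $ j)"
    have W: "W \<in> carrier_mat N k" by (simp add: W_def)
    have "W * ?B = B"
    proof (rule eq_rowI)
      fix i assume "i < dim_row B"
      then have i: "i < N" using B by simp
      have "row W i = y i" using y(1)[OF i] i by (intro eq_vecI) (auto simp: W_def)
      then show "row (W * ?B) i = row B i"
        using row_mult_eq_transpose_mult_vec[OF W Bh i] y(2)[OF i] by simp
    qed (use W Bh B in auto)
    then show "I \<subseteq> {..<N} \<and> card I = k \<and> (\<exists>W \<in> carrier_mat N k. W * ?B = B)"
      using I k W by blast
  next
    assume "I \<subseteq> {..<N} \<and> card I = k \<and> (\<exists>W \<in> carrier_mat N k. W * ?B = B)"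
    then obtain W where W: "W \<in> carrier_mat N k" "W * ?B = B" by blast
    have "?B\<^sup>T *\<^sub>v row W i = row B i" "row W i \<in> carrier_vec k" if "i < N" for i
      using row_mult_eq_transpose_mult_vec[OF W(1) Bh that] W that by auto
    then show "basis_rows B k I" unfolding iff by auto
  qed
next
  case False
  then show ?thesis using B by (auto simp: basis_rows_def)
qed

section \<open>Matrices with orthonormal columns and the bound t\<close>

lemma orthonormal_column_mats_isometry:
  assumes "U \<in> orthonormal_column_mats N r" "x \<in> carrier_vec r"
  shows "vec_norm2 (U *\<^sub>v x) = vec_norm2 x"
proof -
  have U: "U \<in> carrier_mat N r" "mat_adjoint U * U = 1\<^sub>m r"
    using assms by (auto simp: orthonormal_column_mats_def)
  have "complex_of_real ((vec_norm2 (U *\<^sub>v x))\<^sup>2) = complex_of_real ((vec_norm2 x)\<^sup>2)"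
    using gram_cscalar_prod[OF U(1) assms(2) assms(2)] U(2) assms(2) by (simp add: cscalar_prod_self)
  then show ?thesis
    unfolding of_real_eq_iff by (simp add: power2_eq_iff_nonneg)
qed

lemma select_rows_mult_vec:
  assumes "X \<in> carrier_mat N q" "I \<subseteq> {..<N}" "x \<in> carrier_vec q"
  shows "select_rows X I *\<^sub>v x = selection_mat N I *\<^sub>v (X *\<^sub>v x)"
  unfolding select_rows_eq_mult[OF assms(1,2)]
  by (rule assoc_mult_mat_vec[OF selection_mat_carrier assms(1,3)])

lemma uniform_row_selection:
  assumes r: "1 \<le> r" "r \<le> k" "k \<le> N"
  obtains \<delta> where "\<delta> > 0"
    "\<And>U. U \<in> orthonormal_column_mats N r \<Longrightarrow>
      \<exists>I. I \<subseteq> {..<N} \<and> card I = k \<and> \<delta> \<le> sigma_min (select_rows U I)"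
proof -
  obtain C where C: "C \<ge> 0" and piv: "\<And>u :: nat \<Rightarrow> nat \<Rightarrow> complex.
     \<exists>I \<subseteq> {..<N}. card I \<le> r \<and> (\<forall>x. \<forall>l<N.
        cmod (\<Sum>j\<in>{..<r}. u l j * x j) \<le> C * (\<Sum>i\<in>I. cmod (\<Sum>j\<in>{..<r}. u i j * x j)))"
  proof -
    obtain C where "C \<ge> 0" and C: "\<forall>S (u :: nat \<Rightarrow> nat \<Rightarrow> complex). finite S \<and> card S = r \<longrightarrow>
       (\<exists>I \<subseteq> {..<N}. card I \<le> r \<and> (\<forall>x. \<forall>l<N.
          cmod (\<Sum>j\<in>S. u l j * x j) \<le> C * (\<Sum>i\<in>I. cmod (\<Sum>j\<in>S. u i j * x j))))"
      using complete_pivoting[of r N] by blast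
    show ?thesis
      by (rule that[OF \<open>C \<ge> 0\<close>], rule C[rule_format]) simp
  qed
  \<comment> \<open>\<open>real N\<close> comes from summing over all entries of U x,
    \<open>C\<close> from pivoting, and \<open>real k\<close> from bounding each selected entry by
    the norm of the selection. The 1 makes \<open>D\<close> invertible.\<close>
  define D where "D = real N * C * real k + 1"
  have D: "D > 0" using C by (simp add: D_def add_nonneg_pos)
  have "\<exists>I. I \<subseteq> {..<N} \<and> card I = k \<and> inverse D \<le> sigma_min (select_rows U I)"
    if U: "U \<in> orthonormal_column_mats N r" for U
  proof -
    have Uc: "U \<in> carrier_mat N r" using U by (simp add: orthonormal_column_mats_def)
    obtain I0 where I0: "I0 \<subseteq> {..<N}" "card I0 \<le> r" and bound0: "\<forall>x. \<forall>l<N.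
        cmod (\<Sum>j\<in>{..<r}. U $$ (l, j) * x j) \<le> C * (\<Sum>i\<in>I0. cmod (\<Sum>j\<in>{..<r}. U $$ (i, j) * x j))"
      using piv[of "\<lambda>l j. U $$ (l, j)"] by blast
    \<comment> \<open>Pivoting yields at most r rows; padding them to exactly k only enlarges the
      right-hand side.\<close>
    obtain I where I: "I0 \<subseteq> I" "I \<subseteq> {..<N}" "card I = k"
      using exists_subset_between[of I0 k "{..<N}"] I0 r by auto
    have finI: "finite I" using I finite_subset by blast
    have UI: "select_rows U I \<in> carrier_mat k r" using select_rows_carrier[OF Uc I(2)] I by simp
    have "inverse D * vec_norm2 x \<le> vec_norm2 (select_rows U I *\<^sub>v x)" if x: "x \<in> carrier_vec r" for x
    proof -
      define y where "y = U *\<^sub>v x"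
      have y: "y \<in> carrier_vec N" unfolding y_def using Uc x by simp
      have yl: "y $ l = (\<Sum>j\<in>{..<r}. U $$ (l, j) * x $ j)" if "l < N" for l
        unfolding y_def using that Uc x by (auto simp: scalar_prod_def lessThan_atLeast0 intro!: sum.cong)
      let ?n = "vec_norm2 (selection_mat N I *\<^sub>v y)"
      have yi: "cmod (y $ i) \<le> ?n" if "i \<in> I" for i
      proof (rule power2_le_imp_le)
        show "(cmod (y $ i))\<^sup>2 \<le> ?n\<^sup>2"
          unfolding vec_norm2_selection_mat[OF y I(2)] using finI that by (intro member_le_sum) auto
      qed simp
      have bound: "cmod (y $ l) \<le> C * (real k * ?n)" if l: "l < N" for l
      proof -
        have "cmod (y $ l) \<le> C * (\<Sum>i\<in>I0. cmod (\<Sum>j\<in>{..<r}. U $$ (i, j) * x $ j))"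
          unfolding yl[OF l] using bound0 l by blast
        also have "(\<Sum>i\<in>I0. cmod (\<Sum>j\<in>{..<r}. U $$ (i, j) * x $ j)) = (\<Sum>i\<in>I0. cmod (y $ i))"
          using I0 yl by (intro sum.cong) auto
        also have "\<dots> \<le> (\<Sum>i\<in>I. cmod (y $ i))" by (rule sum_mono2[OF finI I(1)]) simp
        also have "\<dots> \<le> real k * ?n" using sum_bounded_above[of I "\<lambda>i. cmod (y $ i)" ?n] yi I by simp
        finally show ?thesis using C by (simp add: mult_left_mono)
      qed
      have "vec_norm2 x = vec_norm2 y"
        unfolding y_def by (rule orthonormal_column_mats_isometry[OF U x, symmetric])
      also have "\<dots> \<le> (\<Sum>l<N. cmod (y $ l))" using vec_norm2_le_sum[of y] y by simp
      also have "\<dots> \<le> real N * (C * (real k * ?n))"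
        using sum_bounded_above[of "{..<N}" "\<lambda>l. cmod (y $ l)"] bound by simp
      also have "\<dots> \<le> D * ?n" by (simp add: D_def algebra_simps)
      finally show ?thesis
        using D by (simp add: select_rows_mult_vec[OF Uc I(2) x] y_def field_simps)
    qed
    then have "inverse D \<le> sigma_min (select_rows U I)"
      using r by (intro sigma_min_greatest[OF UI]) auto
    then show ?thesis using I by blast
  qed
  then show ?thesis using that[of "inverse D"] D by simp
qed

text \<open>\<open>U\<close> preserves lengths and dropping coordinates shortens vectors, so one
  unit vector suffices as a test. This is the source of t >= 1.\<close>

lemma sigma_min_select_rows_le_1:
  assumes U: "U \<in> orthonormal_column_mats N r" and I: "I \<subseteq> {..<N}" and r: "1 \<le> r" "r \<le> card I"
  shows "sigma_min (select_rows U I) \<le> 1"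
proof -
  have Uc: "U \<in> carrier_mat N r" using U by (simp add: orthonormal_column_mats_def)
  let ?e = "unit_vec r 0 :: complex vec"
  have pos: "vec_norm2 ?e > 0"
    using vec_norm2_pos_iff[of ?e r] unit_vec_nonzero[of 0 r] r by simp
  have "sigma_min (select_rows U I) * vec_norm2 ?e \<le> vec_norm2 (select_rows U I *\<^sub>v ?e)"
    using r by (intro sigma_min_mult_le[OF select_rows_carrier[OF Uc I]]) auto
  also have "\<dots> \<le> vec_norm2 (U *\<^sub>v ?e)"
    unfolding select_rows_mult_vec[OF Uc I unit_vec_carrier] using Uc I
    by (intro vec_norm2_selection_mat_le) auto
  also have "\<dots> = vec_norm2 ?e"
    by (rule orthonormal_column_mats_isometry[OF U]) simp
  finally show ?thesis using pos by simp
qed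

lemma t_bound_row_selection:
  assumes r: "1 \<le> r" "r \<le> k" "k \<le> N" and Q: "Q \<in> orthonormal_column_mats N r"
  obtains I where "I \<subseteq> {..<N}" "card I = k" "sigma_min (select_rows Q I) > 0"
    "inverse (sigma_min (select_rows Q I)) \<le> t_bound r N k" "1 \<le> t_bound r N k"
proof -
  obtain \<delta> where \<delta>: "\<delta> > 0" "\<And>U. U \<in> orthonormal_column_mats N r \<Longrightarrow>
      \<exists>I. I \<subseteq> {..<N} \<and> card I = k \<and> \<delta> \<le> sigma_min (select_rows U I)"
    using uniform_row_selection[OF r] by blast
  define E where "E U = {sigma_min (select_rows U I) | I. I \<subseteq> {..<N} \<and> card I = k}" for U
  have finE: "finite (E U)" for U
    unfolding E_def by (rule finite_subset[of _ "(\<lambda>I. sigma_min (select_rows U I)) ` Pow {..<N}"]) auto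
  have \<delta>_le: "\<delta> \<le> Max (E U)" if U: "U \<in> orthonormal_column_mats N r" for U
  proof -
    obtain I where "I \<subseteq> {..<N}" "card I = k" "\<delta> \<le> sigma_min (select_rows U I)"
      using \<delta>(2)[OF U] by blast
    moreover from this have "sigma_min (select_rows U I) \<le> Max (E U)"
      by (intro Max_ge finE) (auto simp: E_def)
    ultimately show ?thesis by simp
  qed
  have "E Q \<noteq> {}" using \<delta>(2)[OF Q] by (auto simp: E_def)
  \<comment> \<open>The finite maximum is attained, so one row set for this particular
    \<open>Q\<close> reaches at least the infimum over all matrices.\<close>
  then have "Max (E Q) \<in> E Q" using finE by (intro Max_in)
  then obtain I where I: "I \<subseteq> {..<N}" "card I = k" and max: "Max (E Q) = sigma_min (select_rows Q I)"
    unfolding E_def by auto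
  define i where "i = (INF U \<in> orthonormal_column_mats N r. Max (E U))"
  have t: "t_bound r N k = inverse i" by (simp add: t_bound_def i_def E_def)
  have "\<delta> \<le> i" unfolding i_def using Q \<delta>_le by (intro cINF_greatest) auto
  then have i0: "i > 0" using \<delta>(1) by simp
  have i_le: "i \<le> sigma_min (select_rows Q I)"
    unfolding i_def max[symmetric] by (intro cINF_lower Q bdd_belowI2[of _ \<delta>] \<delta>_le)
  have "sigma_min (select_rows Q I) \<le> 1"
    using sigma_min_select_rows_le_1[OF Q I(1)] r I by simp
  with i_le have "i \<le> 1" by simp
  then have "1 \<le> inverse i" using i0 by (simp add: one_le_inverse)
  then show ?thesis
    using that[OF I] i0 i_le le_imp_inverse_le[OF i_le i0] by (simp add: t)
qed

text \<open>Stated for a general \<open>B\<close>, since it is applied both to the rows of the left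
  factor of Z and to the columns of the selected rows of A.\<close>

lemma optimal_basis_rows_projection:
  fixes B :: "complex mat"
  assumes B: "B \<in> carrier_mat N q" and inj: "inj_mat B" and q: "1 \<le> q" "q \<le> k" "k \<le> N"
    and opt: "optimal_basis_rows B k I"
  defines "X \<equiv> pseudo_inverse (select_rows B I)" and "S \<equiv> selection_mat N I"
  shows "I \<subseteq> {..<N}" "card I = k" "is_pseudo_inverse (select_rows B I) X" "X \<in> carrier_mat q k"
    "S \<in> carrier_mat k N" "B * X * S * B = B" "t_bound q N k \<ge> 1"
    "\<And>x. x \<in> carrier_vec N \<Longrightarrow> vec_norm2 (x - (B * X * S) *\<^sub>v x) \<le> t_bound q N k * vec_norm2 x"
proof -
  let ?t = "t_bound q N k"
  have basis: "basis_rows B k I"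
    and min: "\<And>I'. basis_rows B k I' \<Longrightarrow>
      spectral_norm (B * X) \<le> spectral_norm (B * pseudo_inverse (select_rows B I'))"
    using opt unfolding optimal_basis_rows_def is_arg_min_def X_def by (auto simp: not_less)
  show I: "I \<subseteq> {..<N}" and card: "card I = k" using basis basis_rows_iff[OF B] by auto
  obtain W where W: "W \<in> carrier_mat N k" "W * select_rows B I = B"
    using basis basis_rows_iff[OF B] by auto
  have Bh: "select_rows B I \<in> carrier_mat k q" using select_rows_carrier[OF B I] card by simp
  \<comment> \<open>As B = W B[I], a kernel vector of the selected rows is a kernel vector of
    \<open>B\<close>.\<close>
  have injBh: "inj_mat (select_rows B I)" by (rule inj_mat_mult_leftD[OF _ W(1) Bh]) (simp add: W inj)
  show pinv: "is_pseudo_inverse (select_rows B I) X" and X: "X \<in> carrier_mat q k"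
    unfolding X_def by (rule is_pseudo_inverse_inj_mat[OF injBh Bh])+
  have XB: "X * select_rows B I = 1\<^sub>m q"
    unfolding X_def by (rule is_pseudo_inverse_inj_mat[OF injBh Bh])
  show S: "S \<in> carrier_mat k N" unfolding S_def using card by auto
  have SB: "S * B = select_rows B I" unfolding S_def by (rule select_rows_eq_mult[OF B I, symmetric])
  have BX: "B * X \<in> carrier_mat N k" using B X by simp
  have BXS: "B * X * S \<in> carrier_mat N N" using BX S by simp
  show BXSB: "B * X * S * B = B"
    unfolding assoc_mult_mat[OF BX S B] SB assoc_mult_mat[OF B X Bh] XB using B by simp
  have idem: "(B * X * S) * (B * X * S) = B * X * S"
    unfolding assoc_mult_mat[OF BXS BX S, symmetric] assoc_mult_mat[OF BXS B X, symmetric] BXSB ..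
  obtain Q T where Q: "Q \<in> orthonormal_column_mats N q" and T: "T \<in> carrier_mat q q" and QT: "B = Q * T"
    using qr_decomposition[OF B inj] by blast
  have Qc: "Q \<in> carrier_mat N q" using Q by (simp add: orthonormal_column_mats_def)
  obtain I' where I': "I' \<subseteq> {..<N}" "card I' = k" and \<sigma>: "sigma_min (select_rows Q I') > 0"
    and inv_le: "inverse (sigma_min (select_rows Q I')) \<le> ?t" and t1: "1 \<le> ?t"
    using t_bound_row_selection[OF q Q] by blast
  show "?t \<ge> 1" by (rule t1)
  let ?Q = "select_rows Q I'" and ?B = "select_rows B I'"
  have Qh: "?Q \<in> carrier_mat k q" and Bh': "?B \<in> carrier_mat k q"
    using select_rows_carrier[OF Qc I'(1)] select_rows_carrier[OF B I'(1)] I' by simp_all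
  \<comment> \<open>\<open>T\<close> acts alike on \<open>B\<close> and on its selected rows, so the
    estimate for \<open>Q\<close> transfers whatever the conditioning of \<open>T\<close>.\<close>
  have le: "vec_norm2 (B *\<^sub>v x) \<le> ?t * vec_norm2 (?B *\<^sub>v x)" if x: "x \<in> carrier_vec q" for x
  proof -
    have Tx: "T *\<^sub>v x \<in> carrier_vec q" using T x by simp
    have Bx: "B *\<^sub>v x = Q *\<^sub>v (T *\<^sub>v x)" unfolding QT by (rule assoc_mult_mat_vec[OF Qc T x])
    have Bhx: "?B *\<^sub>v x = ?Q *\<^sub>v (T *\<^sub>v x)"
      unfolding select_rows_mult_vec[OF B I'(1) x] Bx select_rows_mult_vec[OF Qc I'(1) Tx] ..
    have "vec_norm2 (B *\<^sub>v x) = vec_norm2 (T *\<^sub>v x)"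
      unfolding Bx by (rule orthonormal_column_mats_isometry[OF Q Tx])
    also have "\<dots> \<le> inverse (sigma_min ?Q) * vec_norm2 (?Q *\<^sub>v (T *\<^sub>v x))"
      using sigma_min_mult_le[OF Qh _ _ Tx] q \<sigma> by (simp add: field_simps)
    also have "\<dots> \<le> ?t * vec_norm2 (?B *\<^sub>v x)"
      unfolding Bhx by (intro mult_right_mono inv_le) simp
    finally show ?thesis .
  qed
  have injBh': "inj_mat ?B"
  proof (rule inj_matI[OF Bh'])
    fix x assume x: "x \<in> carrier_vec q" "?B *\<^sub>v x = 0\<^sub>v k"
    then have "vec_norm2 (B *\<^sub>v x) = 0" using le[OF x(1)] vec_norm2_nonneg[of "B *\<^sub>v x"] by simp
    then have "B *\<^sub>v x = 0\<^sub>v N" using vec_norm2_eq_0_iff[of "B *\<^sub>v x" N] B x by simp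
    then show "x = 0\<^sub>v q" by (rule inj_matD[OF inj B x(1)])
  qed
  define Y where "Y = pseudo_inverse ?B"
  have Y: "Y \<in> carrier_mat q k" "is_pseudo_inverse ?B Y" "Y * ?B = 1\<^sub>m q"
    unfolding Y_def by (rule is_pseudo_inverse_inj_mat[OF injBh' Bh'])+
  have BY: "B * Y \<in> carrier_mat N k" using B Y by simp
  have "B * Y * ?B = B" unfolding assoc_mult_mat[OF B Y(1) Bh'] Y(3) using B by simp
  \<comment> \<open>\<open>B * Y\<close> plays the part of \<open>W\<close>, which admits
    \<open>I'\<close> to the comparison with the optimal \<open>I\<close>.\<close>
  then have "basis_rows B k I'" unfolding basis_rows_iff[OF B] using I' BY by blast
  then have "spectral_norm (B * X) \<le> spectral_norm (B * Y)" unfolding Y_def by (rule min)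
  also have "\<dots> \<le> ?t"
  proof (rule spectral_norm_le[OF BY])
    fix y :: "complex vec" assume y: "y \<in> carrier_vec k"
    have Yy: "Y *\<^sub>v y \<in> carrier_vec q" using Y y by simp
    have "vec_norm2 ((B * Y) *\<^sub>v y) \<le> ?t * vec_norm2 (?B *\<^sub>v (Y *\<^sub>v y))"
      unfolding assoc_mult_mat_vec[OF B Y(1) y] by (rule le[OF Yy])
    \<comment> \<open>\<open>?B * Y\<close> is an orthogonal projection, so the pseudo-inverse adds
      no further factor.\<close>
    also have "\<dots> \<le> ?t * vec_norm2 y"
      using t1 by (intro mult_left_mono pseudo_inverse_projection_bound[OF Y(2) Bh' y]) auto
    finally show "vec_norm2 ((B * Y) *\<^sub>v y) \<le> ?t * vec_norm2 y" .
  qed (use t1 in simp)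
  finally have norm_BX: "spectral_norm (B * X) \<le> ?t" .
  have "vec_norm2 ((B * X * S) *\<^sub>v x) \<le> ?t * vec_norm2 x" if x: "x \<in> carrier_vec N" for x
  proof -
    have Sx: "S *\<^sub>v x \<in> carrier_vec k" using S x by simp
    have "vec_norm2 ((B * X * S) *\<^sub>v x) \<le> spectral_norm (B * X) * vec_norm2 (S *\<^sub>v x)"
      unfolding assoc_mult_mat_vec[OF BX S x] by (rule mult_mat_vec_le_spectral_norm[OF BX Sx])
    also have "\<dots> \<le> ?t * vec_norm2 x"
      using t1 norm_BX unfolding S_def by (intro mult_mono vec_norm2_selection_mat_le x I) auto
    finally show ?thesis .
  qed
  then show "vec_norm2 (x - (B * X * S) *\<^sub>v x) \<le> ?t * vec_norm2 x" if "x \<in> carrier_vec N" for x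
    by (rule oblique_projection_complement_bound[OF BXS idem t1 _ that])
qed

section \<open>The error between two complementary projections\<close>

theorem theorem4p5:
  fixes A Z F A\<^sub>t :: "complex mat" and N M r n m :: nat and \<epsilon> :: real
  assumes "A \<in> carrier_mat N M" and "Z \<in> carrier_mat N M" and "F \<in> carrier_mat N M"
    and "A = Z + F"
    and "vec_space.rank N Z = r" and "r \<ge> 1"
    and "spectral_norm F \<le> \<epsilon>"
    and "m \<ge> n" and "n \<ge> r" and "n < N" and "m < M"
    and "optimal_pseudo_skeleton_approximant A Z r n m A\<^sub>t"
  shows "spectral_norm (A - A\<^sub>t) \<le> \<epsilon> * t_bound n M m * t_bound r N n"
proof -
  note A = assms(1) and Z = assms(2) and F = assms(3)
  obtain Z\<^sub>U Z\<^sub>V I J where ZU: "Z\<^sub>U \<in> carrier_mat N r" and ZV: "Z\<^sub>V \<in> carrier_mat r M"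
    and ZUV: "Z = Z\<^sub>U * Z\<^sub>V" and optI: "optimal_basis_rows Z\<^sub>U n I"
    and rankR: "vec_space.rank n (select_rows A I) = n"
    and optJ: "optimal_basis_rows (select_rows A I)\<^sup>T m J"
    and At: "A\<^sub>t = pseudo_skeleton A I J"
    using assms(12) Z unfolding optimal_pseudo_skeleton_approximant_def optimal_basis_columns_def by auto
  have injZU: "inj_mat Z\<^sub>U" using full_rank_factor_inj[OF ZU ZV] assms(5) ZUV by simp
  have "n \<le> N" using assms(10) by simp
  note row_facts = optimal_basis_rows_projection[OF ZU injZU assms(6) assms(9) \<open>n \<le> N\<close> optI]
  note I = row_facts(1,2)
  define R where "R = select_rows A I"
  have R: "R \<in> carrier_mat n M" unfolding R_def using select_rows_carrier[OF A I(1)] I by simp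
  have Rt: "R\<^sup>T \<in> carrier_mat M n" using R by simp
  have injRt: "inj_mat R\<^sup>T" using full_row_rank_transpose_inj[OF R] rankR by (simp add: R_def)
  have n1: "1 \<le> n" and mM: "m \<le> M" using assms by auto
  \<comment> \<open>The column choice read as a row choice for \<open>R\<^sup>T\<close>, with n in
    place of r. The projection acting on the right of A is therefore the transpose of
    \<open>P2\<close> below.\<close>
  note col_facts = optimal_basis_rows_projection[OF Rt injRt n1 assms(8) mM optJ[folded R_def]]
  note J = col_facts(1,2)
  define t1 t2 where "t1 = t_bound r N n" and "t2 = t_bound n M m"
  define X1 S1 where "X1 = pseudo_inverse (select_rows Z\<^sub>U I)" and "S1 = selection_mat N I"
  define X2 S2 where "X2 = pseudo_inverse (select_rows R\<^sup>T J)" and "S2 = selection_mat M J"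
  have X1: "X1 \<in> carrier_mat r n" and S1: "S1 \<in> carrier_mat n N"
    and P1Z: "Z\<^sub>U * X1 * S1 * Z\<^sub>U = Z\<^sub>U" and t1: "t1 \<ge> 1"
    and bound1: "\<And>x. x \<in> carrier_vec N \<Longrightarrow> vec_norm2 (x - (Z\<^sub>U * X1 * S1) *\<^sub>v x) \<le> t1 * vec_norm2 x"
    using row_facts unfolding X1_def S1_def t1_def by auto
  have X2: "X2 \<in> carrier_mat n m" and S2: "S2 \<in> carrier_mat m M"
    and pinv2: "is_pseudo_inverse (select_rows R\<^sup>T J) X2"
    and P2R: "R\<^sup>T * X2 * S2 * R\<^sup>T = R\<^sup>T" and t2: "t2 \<ge> 1"
    and bound2: "\<And>x. x \<in> carrier_vec M \<Longrightarrow> vec_norm2 (x - (R\<^sup>T * X2 * S2) *\<^sub>v x) \<le> t2 * vec_norm2 x"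
    using col_facts unfolding X2_def S2_def t2_def by auto
  define P1 P2 where "P1 = Z\<^sub>U * X1 * S1" and "P2 = R\<^sup>T * X2 * S2"
  have ZX: "Z\<^sub>U * X1 \<in> carrier_mat N n" using ZU X1 by simp
  have P1: "P1 \<in> carrier_mat N N" unfolding P1_def using ZX S1 by simp
  have RX: "R\<^sup>T * X2 \<in> carrier_mat M m" using Rt X2 by simp
  have P2: "P2 \<in> carrier_mat M M" unfolding P2_def using RX S2 by simp
  have P2t: "P2\<^sup>T \<in> carrier_mat M M" using P2 by simp
  have S2t: "S2\<^sup>T \<in> carrier_mat M m" and X2t: "X2\<^sup>T \<in> carrier_mat m n" using S2 X2 by auto
  have S1A: "S1 * A = R" unfolding S1_def R_def by (rule select_rows_eq_mult[OF A I(1), symmetric])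

  have cols: "select_cols A J = A * S2\<^sup>T"
  proof -
    have At: "A\<^sup>T \<in> carrier_mat M N" using A by simp
    show ?thesis
      unfolding select_cols_eq_transpose[OF A J(1)] select_rows_eq_mult[OF At J(1)]
      using transpose_mult[OF S2 At] by (simp add: S2_def)
  qed
  have "pseudo_inverse (submatrix A I J) = X2\<^sup>T"
    unfolding submatrix_eq_transpose[OF A I(1) J(1)]
    using is_pseudo_inverse_transpose[OF pinv2] by (intro pseudo_inverse_eqI) (simp add: R_def)
  then have "A\<^sub>t = A * S2\<^sup>T * X2\<^sup>T * R" by (simp add: At pseudo_skeleton_def cols R_def)
  also have "\<dots> = A * (S2\<^sup>T * (X2\<^sup>T * R))"
    using assoc_mult_mat[OF mult_carrier_mat[OF A S2t] X2t R]
      assoc_mult_mat[OF A S2t mult_carrier_mat[OF X2t R]] by simp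
  also have "S2\<^sup>T * (X2\<^sup>T * R) = P2\<^sup>T"
    unfolding P2_def using transpose_mult[OF RX S2] transpose_mult[OF Rt X2] by simp
  finally have AtP2: "A\<^sub>t = A * P2\<^sup>T" .
  then have Atc: "A\<^sub>t \<in> carrier_mat N M" using mult_carrier_mat[OF A P2t] by simp
  have RP2: "R * P2\<^sup>T = R"
    using arg_cong[OF P2R, of transpose_mat] transpose_mult[OF P2 Rt] by (simp add: P2_def)

  have t12: "t1 \<ge> 0" "t2 \<ge> 0" using t1 t2 by auto
  \<comment> \<open>Only \<open>1 - P2\<close> has been bounded so far; the error involves its
    transpose, which obeys the same bound.\<close>
  have compl2: "vec_norm2 (x - P2\<^sup>T *\<^sub>v x) \<le> t2 * vec_norm2 x" if x: "x \<in> carrier_vec M" for x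
  proof -
    have D: "1\<^sub>m M - P2 \<in> carrier_mat M M" by (rule minus_carrier_mat[OF P2])
    have "vec_norm2 ((1\<^sub>m M - P2)\<^sup>T *\<^sub>v x) \<le> t2 * vec_norm2 x"
    proof (rule transpose_mult_vec_bound[OF D t12(2) _ x])
      fix z :: "complex vec" assume z: "z \<in> carrier_vec M"
      show "vec_norm2 ((1\<^sub>m M - P2) *\<^sub>v z) \<le> t2 * vec_norm2 z"
        using bound2[OF z] minus_mult_distrib_mat_vec[OF one_carrier_mat P2 z] z by (simp add: P2_def)
    qed
    moreover have "(1\<^sub>m M - P2)\<^sup>T = 1\<^sub>m M - P2\<^sup>T"
      using P2 by (intro eq_matI) auto
    ultimately show ?thesis
      using minus_mult_distrib_mat_vec[OF one_carrier_mat P2t x] x by simp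
  qed

  have eps: "\<epsilon> \<ge> 0"
    using spectral_norm_nonneg[of F] assms(7) by simp
  show ?thesis
  proof (rule spectral_norm_le[OF minus_carrier_mat[OF Atc]])
    show "0 \<le> \<epsilon> * t_bound n M m * t_bound r N n"
      using t12 eps by (simp add: t1_def t2_def)
    fix x :: "complex vec" assume x: "x \<in> carrier_vec M"
    have P2x: "P2\<^sup>T *\<^sub>v x \<in> carrier_vec M" using P2t x by simp
    define y where "y = x - P2\<^sup>T *\<^sub>v x"
    have y: "y \<in> carrier_vec M" unfolding y_def using x P2x by simp
    have Ay: "A *\<^sub>v y \<in> carrier_vec N" and Fy: "F *\<^sub>v y \<in> carrier_vec N" and Zy: "Z *\<^sub>v y \<in> carrier_vec N"
      using A F Z y by auto
    have "(A - A\<^sub>t) *\<^sub>v x = A *\<^sub>v x - A\<^sub>t *\<^sub>v x"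
      by (rule minus_mult_distrib_mat_vec[OF A Atc x])
    also have "A\<^sub>t *\<^sub>v x = A *\<^sub>v (P2\<^sup>T *\<^sub>v x)"
      unfolding AtP2 by (rule assoc_mult_mat_vec[OF A P2t x])
    also have "A *\<^sub>v x - \<dots> = A *\<^sub>v y"
      unfolding y_def by (rule mult_minus_distrib_mat_vec[OF A x P2x, symmetric])
    finally have AAt: "(A - A\<^sub>t) *\<^sub>v x = A *\<^sub>v y" .
    have "R *\<^sub>v y = R *\<^sub>v x - (R * P2\<^sup>T) *\<^sub>v x"
      unfolding y_def assoc_mult_mat_vec[OF R P2t x] by (rule mult_minus_distrib_mat_vec[OF R x P2x])
    then have Ry: "R *\<^sub>v y = 0\<^sub>v n" unfolding RP2 using R x by simp
    have "P1 *\<^sub>v (A *\<^sub>v y) = (Z\<^sub>U * X1) *\<^sub>v (R *\<^sub>v y)"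
      unfolding P1_def assoc_mult_mat_vec[OF ZX S1 Ay] S1A[symmetric] assoc_mult_mat_vec[OF S1 A y] ..
    then have P1A: "P1 *\<^sub>v (A *\<^sub>v y) = 0\<^sub>v N" unfolding Ry using ZX by simp
    have "P1 * Z = Z"
      unfolding ZUV using assoc_mult_mat[OF P1 ZU ZV] P1Z by (simp add: P1_def)
    then have P1Zy: "P1 *\<^sub>v (Z *\<^sub>v y) = Z *\<^sub>v y" using assoc_mult_mat_vec[OF P1 Z y] by simp
    have AZF: "A *\<^sub>v y = Z *\<^sub>v y + F *\<^sub>v y"
      unfolding assms(4) by (rule add_mult_distrib_mat_vec[OF Z F y])
    define w where "w = P1 *\<^sub>v (F *\<^sub>v y)"
    have w: "w \<in> carrier_vec N" unfolding w_def using P1 Fy by simp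
    \<comment> \<open>This is P1 (A y) = 0 split along A = Z + F, with \<open>P1\<close> fixing Z y.
      It trades Z y for - w, so that no norm of Z enters the estimate.\<close>
    have sum0: "Z *\<^sub>v y + w = 0\<^sub>v N"
      using P1A unfolding AZF mult_add_distrib_mat_vec[OF P1 Zy Fy] P1Zy w_def .
    have "A *\<^sub>v y = F *\<^sub>v y - w"
    proof (rule eq_vecI)
      fix i assume "i < dim_vec (F *\<^sub>v y - w)"
      then have i: "i < N" using w by simp
      have "(Z *\<^sub>v y) $ i + w $ i = 0"
        using arg_cong[OF sum0, of "\<lambda>v. v $ i"] i w Zy by (simp del: index_mult_mat_vec)
      then show "(A *\<^sub>v y) $ i = (F *\<^sub>v y - w) $ i"
        unfolding AZF using i w Zy Fy Z F by (simp del: index_mult_mat_vec add: eq_neg_iff_add_eq_0[symmetric])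
    qed (use Ay w A in simp)
    then have "vec_norm2 ((A - A\<^sub>t) *\<^sub>v x) \<le> t1 * vec_norm2 (F *\<^sub>v y)"
      unfolding AAt using bound1[OF Fy] by (simp add: P1_def w_def)
    also have "\<dots> \<le> t1 * (\<epsilon> * vec_norm2 y)"
      using mult_mat_vec_le_spectral_norm[OF F y] mult_right_mono[OF assms(7), of "vec_norm2 y"] t12
      by (intro mult_left_mono) auto
    also have "\<dots> \<le> t1 * (\<epsilon> * (t2 * vec_norm2 x))"
      unfolding y_def using t12 eps by (intro mult_left_mono compl2 x) auto
    finally show "vec_norm2 ((A - A\<^sub>t) *\<^sub>v x) \<le> \<epsilon> * t_bound n M m * t_bound r N n * vec_norm2 x"
      by (simp add: t1_def t2_def mult_ac)
  qed
qed

end
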